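(* Assume the signal--entropy separation assumption and the mild-growth assumption on $K$ (stated in the context), and suppose in addition that $a,b=o(n)$, $a\gtrsim\log n$ and $K=O(1)$. Then the feasibility condition $$\varepsilon\gtrsim\Delta_a\frac{K\log(nK)}{nI}$$ reduces to (i.e. is equivalent, up to constants, to) $$\varepsilon\gtrsim\log n .$$ Consequently a logarithmic privacy budget is sufficient for the following conclusion: there are constants $L,c_0,c_1,C_0,C_1>0$ such that, if $\varepsilon\ge L\log n$, then with $B:=C_0\frac{K\log(nK)}{nI}$, $\eta:=\frac{\varepsilon}{4\Delta_a}$, $\gamma_0:=\eta-B$ one has $\gamma_0>0$, and for every $0<\alpha<\frac12$, with $s^\star:=\frac{C_1\log(nK)+\log(4/\alpha)}{\gamma_0}$, $$\mathbb E\,r(\sigma_0,\hat\sigma_f)\le\exp\{-(1+o(1))\,\mathrm{Signal}+t^\star s^\star\}+\alpha+e^{-c_0\,\mathrm{Signal}}+e^{-c_1(a+\log n)};$$ moreover, if $\eta\ge2B$, then $$\mathbb E\,r(\sigma_0,\hat\sigma_f)\le \exp\Big\{-(1+o(1))\,\mathrm{Signal}+O\Big(\Delta_a\frac{\log(nK)}{\varepsilon}\Big)+O(\Delta_a)\Big\}+\frac{1}{nK}e^{-\Omega(\varepsilon)}+e^{-c_0\,\mathrm{Signal}}+e^{-c_1(a+\log n)},$$ which is obtained by choosing, for any fixed $c_3>0$, $\alpha:=\frac{1}{nK}e^{-c_3\varepsilon/2}$, for which $s^\star\lesssim\Delta_a\frac{\log(nK)}{\varepsilon}+\Delta_a$.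
   Context: Graphs. $\mathcal G$ is the set of simple undirected graphs on $[n]=\{1,\dots,n\}$, identified with symmetric zero-diagonal matrices $A\in\{0,1\}^{n\times n}$. Write $A\sim_v A'$ (node-adjacent) if $A,A'$ differ only in the incident edges of a single vertex $v$. A randomized mechanism $M$ on $\mathcal G$ is $\varepsilon$-node-DP if $\mathbb P(M(A)\in S)\le e^{\varepsilon}\,\mathbb P(M(A')\in S)$ for all measurable $S$ and all $A\sim_v A'$. Model. $n\ge2$, $K\ge 2$, $\beta\ge 1$, and if $K\ge3$ also $1\le\beta<\sqrt{5/3}$. The parameters $K,a,b,\varepsilon$ may depend on $n$; asymptotic notation is as $n\to\infty$, and logarithms are natural. $\Sigma_\beta$ is the set of $\sigma:[n]\to[K]$ with $\frac{n}{\beta K}\le|\{i:\sigma(i)=k\}|\le\frac{\beta n}{K}$ for all $k\in[K]$. For $\sigma_0\in\Sigma_\beta$ and $n>a>b\ge 0$, $A\sim\mathrm{SBM}(\sigma_0)$ means: the entries $A_{ij}$, $i<j$, are independent with $\mathbb P(A_{ij}=1)=a/n$ if $\sigma_0(i)=\sigma_0(j)$ and $b/n$ otherwise. Constant-SNR standing assumption: there are constants $0<\rho_-\le\rho_+<1$ with $\rho_-\le b/a\le\rho_+$ for all large $n$. Constants do not depend on $n$; the regime parameters $\rho_\pm$, $\beta$ and the bound on $K$ are regarded as fixed. $x\lesssim y$ means $x\le C'y$ for a constant $C'>0$. Loss. $r(\sigma,\hat\sigma):=\min_{\pi\in S_K}\frac1n\sum_{i=1}^n\mathbf 1\{\sigma(i)\ne\pi(\hat\sigma(i))\}$,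 with $S_K$ the permutations of $[K]$. Expectations are under $A\sim\mathrm{SBM}(\sigma_0)$, $\sigma_0\in\Sigma_\beta$. Information. $I=-2\log\big(\sqrt{\tfrac an\tfrac bn}+\sqrt{(1-\tfrac an)(1-\tfrac bn)}\big)$; $\mathrm{Signal}:=nI/2$ if $K=2$ and $\mathrm{Signal}:=nI/(\beta K)$ if $K\ge3$. Score. $T_A(\sigma)=\sum_{i<j}(A_{ij}-\lambda)\mathbf 1\{\sigma(i)=\sigma(j)\}$, where $t^\star=\frac12\log\frac{a(1-b/n)}{b(1-a/n)}$ and $\lambda=-\frac{w}{t^\star}\log(\frac an e^{-t^\star}+1-\frac an)+\frac{1-w}{t^\star}\log(\frac bn e^{t^\star}+1-\frac bn)$, with $w=1/2$ if $K=2$ and any fixed $w\in[0,1]$ if $K\ge3$. Degree envelope. $\mathcal G_C:=\{A:\max_i\deg_A(i)\le C\max\{a,\log n\}\}$, where $C>0$ is a fixed constant, large enough that $\mathbb P(A\in\mathcal G_C)\ge1-\exp(-10(a+\log n))$ under the SBM for all $n$. $\Delta_a:=2C\max\{a,\log n\}$. Estimator. For $A\in\mathcal G_C$ and $\varepsilon_0:=\varepsilon/2$, the restricted Exponential Mechanism outputs $\sigma\in\Sigma_\beta$ with probability $\exp(\frac{\varepsilon_0}{2\Delta_a}T_A(\sigma))/\sum_{\tau\in\Sigma_\beta}\exp(\frac{\varepsilon_0}{2\Delta_a}T_A(\tau))$. The algorithm $\hat\sigma_f$ is an extension of it to all of $\mathcal G$: a mechanism $\mathcal G\to\Sigma_\beta$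 that is $\varepsilon$-node-DP and whose output law at every $A\in\mathcal G_C$ equals that of the restricted mechanism (such an extension exists, by a known general extension lemma for differentially private mechanisms on metric spaces). Signal--entropy separation assumption: for a sufficiently large absolute constant $C_s>0$, $\mathrm{Signal}\ge C_s\log(nK)$ for all sufficiently large $n$. Mild-growth assumption: there is an absolute constant $C_{\mathrm{mg}}>0$ with $\log(nK)\ge C_{\mathrm{mg}}K\log K$ for all sufficiently large $n$. *)

theory Defs
  imports
    "HOL-Probability.Probability"
    "HOL-Library.Landau_Symbols"
    "HOL-Combinatorics.Permutations"
begin

(* A graph on [n] = {1..n} is its adjacency matrix, with entries of type bool (read as 0/1 through
   of_bool) and False outside of [n] x [n]. *)
type_synonym graph = "nat \<Rightarrow> nat \<Rightarrow> bool"

definition graphs :: "nat \<Rightarrow> graph set" where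
  "graphs n = {A. (\<forall>i j. A i j \<longrightarrow> i \<in> {1..n} \<and> j \<in> {1..n} \<and> A j i) \<and> (\<forall>i. \<not> A i i)}"

definition node_adjacent :: "nat \<Rightarrow> graph \<Rightarrow> graph \<Rightarrow> bool" where
  "node_adjacent v A A' \<longleftrightarrow> (\<forall>i j. i \<noteq> v \<longrightarrow> j \<noteq> v \<longrightarrow> A i j = A' i j)"

(* All output spaces here are finite, so a randomized mechanism is a pmf-valued function and
   every set of outputs is measurable. *)
definition node_DP :: "nat \<Rightarrow> real \<Rightarrow> (graph \<Rightarrow> 'o pmf) \<Rightarrow> bool" where
  "node_DP n \<epsilon> M \<longleftrightarrow>
     (\<forall>v \<in> {1..n}. \<forall>A \<in> graphs n. \<forall>A' \<in> graphs n. node_adjacent v A A' \<longrightarrow>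
        (\<forall>S. measure_pmf.prob (M A) S \<le> exp \<epsilon> * measure_pmf.prob (M A') S))"

definition pairs :: "nat \<Rightarrow> (nat \<times> nat) set" where
  "pairs n = {(i, j). 1 \<le> i \<and> i < j \<and> j \<le> n}"

definition balanced :: "nat \<Rightarrow> nat \<Rightarrow> real \<Rightarrow> (nat \<Rightarrow> nat) set" where
  "balanced n K \<beta> = {\<sigma> \<in> {1..n} \<rightarrow>\<^sub>E {1..K}. \<forall>k \<in> {1..K}.
     real n / (\<beta> * real K) \<le> real (card {i \<in> {1..n}. \<sigma> i = k}) \<and>
     real (card {i \<in> {1..n}. \<sigma> i = k}) \<le> \<beta> * real n / real K}"

definition SBM :: "nat \<Rightarrow> real \<Rightarrow> real \<Rightarrow> (nat \<Rightarrow> nat) \<Rightarrow> graph pmf" where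
  "SBM n a b \<sigma> =
     map_pmf (\<lambda>E i j. if i < j then E (i, j) else if j < i then E (j, i) else False)
       (Pi_pmf (pairs n) False
         (\<lambda>(i, j). bernoulli_pmf (if \<sigma> i = \<sigma> j then a / real n else b / real n)))"

definition loss :: "nat \<Rightarrow> nat \<Rightarrow> (nat \<Rightarrow> nat) \<Rightarrow> (nat \<Rightarrow> nat) \<Rightarrow> real" where
  "loss n K \<sigma> \<sigma>' =
     (MIN \<pi> \<in> {\<pi>. \<pi> permutes {1..K}}. (1 / real n) * (\<Sum>i = 1..n. of_bool (\<sigma> i \<noteq> \<pi> (\<sigma>' i))))"

definition info :: "nat \<Rightarrow> real \<Rightarrow> real \<Rightarrow> real" where
  "info n a b =
     - 2 * ln (sqrt ((a / real n) * (b / real n)) + sqrt ((1 - a / real n) * (1 - b / real n)))"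

definition Signal :: "nat \<Rightarrow> nat \<Rightarrow> real \<Rightarrow> real \<Rightarrow> real \<Rightarrow> real" where
  "Signal n K \<beta> a b =
     (if K = 2 then real n * info n a b / 2 else real n * info n a b / (\<beta> * real K))"

definition tstar :: "nat \<Rightarrow> real \<Rightarrow> real \<Rightarrow> real" where
  "tstar n a b = 1 / 2 * ln (a * (1 - b / real n) / (b * (1 - a / real n)))"

(* The weight w is only free for K >= 3. *)
definition penalty :: "nat \<Rightarrow> nat \<Rightarrow> real \<Rightarrow> real \<Rightarrow> real \<Rightarrow> real" where
  "penalty n K w a b =
     (let t = tstar n a b; w' = (if K = 2 then 1 / 2 else w) in
        - (w' / t) * ln (a / real n * exp (- t) + 1 - a / real n)
        + (1 - w') / t * ln (b / real n * exp t + 1 - b / real n))"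

definition score :: "nat \<Rightarrow> real \<Rightarrow> graph \<Rightarrow> (nat \<Rightarrow> nat) \<Rightarrow> real" where
  "score n lam A \<sigma> = (\<Sum>(i, j) \<in> pairs n. (of_bool (A i j) - lam) * of_bool (\<sigma> i = \<sigma> j))"

definition deg :: "nat \<Rightarrow> graph \<Rightarrow> nat \<Rightarrow> nat" where
  "deg n A i = card {j \<in> {1..n}. A i j}"

definition envelope :: "nat \<Rightarrow> real \<Rightarrow> real \<Rightarrow> graph set" where
  "envelope n C a = {A \<in> graphs n. \<forall>i \<in> {1..n}. real (deg n A i) \<le> C * max a (ln (real n))}"

definition sens :: "nat \<Rightarrow> real \<Rightarrow> real \<Rightarrow> real" where
  "sens n C a = 2 * C * max a (ln (real n))"

(* Output probability of sigma under the restricted exponential mechanism with budget eps / 2. *)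
definition exp_mech_prob ::
  "nat \<Rightarrow> nat \<Rightarrow> real \<Rightarrow> real \<Rightarrow> real \<Rightarrow> real \<Rightarrow> real \<Rightarrow> real \<Rightarrow> graph \<Rightarrow> (nat \<Rightarrow> nat) \<Rightarrow> real"
where
  "exp_mech_prob n K \<beta> w C a b \<epsilon> A \<sigma> =
     (let T = score n (penalty n K w a b) A; \<epsilon>0 = \<epsilon> / 2 in
        exp (\<epsilon>0 / (2 * sens n C a) * T \<sigma>) /
        (\<Sum>\<tau> \<in> balanced n K \<beta>. exp (\<epsilon>0 / (2 * sens n C a) * T \<tau>)))"

definition private_extension ::
  "nat \<Rightarrow> nat \<Rightarrow> real \<Rightarrow> real \<Rightarrow> real \<Rightarrow> real \<Rightarrow> real \<Rightarrow> real \<Rightarrow> (graph \<Rightarrow> (nat \<Rightarrow> nat) pmf) \<Rightarrow> bool"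
where
  "private_extension n K \<beta> w C a b \<epsilon> M \<longleftrightarrow>
     (\<forall>A \<in> graphs n. set_pmf (M A) \<subseteq> balanced n K \<beta>) \<and>
     node_DP n \<epsilon> M \<and>
     (\<forall>A \<in> envelope n C a. \<forall>\<sigma> \<in> balanced n K \<beta>.
        pmf (M A) \<sigma> = exp_mech_prob n K \<beta> w C a b \<epsilon> A \<sigma>)"

definition risk ::
  "nat \<Rightarrow> nat \<Rightarrow> real \<Rightarrow> real \<Rightarrow> (nat \<Rightarrow> nat) \<Rightarrow> (graph \<Rightarrow> (nat \<Rightarrow> nat) pmf) \<Rightarrow> real" where
  "risk n K a b \<sigma> M =
     measure_pmf.expectation (bind_pmf (SBM n a b \<sigma>) M) (\<lambda>\<sigma>'. loss n K \<sigma> \<sigma>')"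

definition model :: "real \<Rightarrow> (nat \<Rightarrow> nat) \<Rightarrow> (nat \<Rightarrow> real) \<Rightarrow> (nat \<Rightarrow> real) \<Rightarrow> bool" where
  "model \<beta> K a b \<longleftrightarrow> 1 \<le> \<beta> \<and>
     (\<forall>n \<ge> 2. 2 \<le> K n \<and> (3 \<le> K n \<longrightarrow> \<beta> < sqrt (5 / 3)) \<and>
        0 \<le> b n \<and> b n < a n \<and> a n < real n)"

definition constant_SNR :: "real \<Rightarrow> real \<Rightarrow> (nat \<Rightarrow> real) \<Rightarrow> (nat \<Rightarrow> real) \<Rightarrow> bool" where
  "constant_SNR \<rho>\<^sub>1 \<rho>\<^sub>2 a b \<longleftrightarrow>
     (\<forall>\<^sub>F n in sequentially. \<rho>\<^sub>1 \<le> b n / a n \<and> b n / a n \<le> \<rho>\<^sub>2)"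

definition envelope_whp ::
  "real \<Rightarrow> real \<Rightarrow> (nat \<Rightarrow> nat) \<Rightarrow> (nat \<Rightarrow> real) \<Rightarrow> (nat \<Rightarrow> real) \<Rightarrow> bool" where
  "envelope_whp C \<beta> K a b \<longleftrightarrow>
     (\<forall>n \<ge> 2. \<forall>\<sigma> \<in> balanced n (K n) \<beta>.
        measure_pmf.prob (SBM n (a n) (b n) \<sigma>) (envelope n C (a n))
          \<ge> 1 - exp (- 10 * (a n + ln (real n))))"

definition signal_entropy_separation ::
  "real \<Rightarrow> real \<Rightarrow> (nat \<Rightarrow> nat) \<Rightarrow> (nat \<Rightarrow> real) \<Rightarrow> (nat \<Rightarrow> real) \<Rightarrow> bool" where
  "signal_entropy_separation Cs \<beta> K a b \<longleftrightarrow>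
     (\<forall>\<^sub>F n in sequentially. Signal n (K n) \<beta> (a n) (b n) \<ge> Cs * ln (real (n * K n)))"

definition mild_growth :: "(nat \<Rightarrow> nat) \<Rightarrow> bool" where
  "mild_growth K \<longleftrightarrow>
     (\<exists>Cmg > 0. \<forall>\<^sub>F n in sequentially. ln (real (n * K n)) \<ge> Cmg * real (K n) * ln (real (K n)))"

(* The condition K = O(1) is spelt out with its bound Kmax, on which constants may depend. *)
definition regime ::
  "real \<Rightarrow> real \<Rightarrow> real \<Rightarrow> real \<Rightarrow> nat \<Rightarrow> real \<Rightarrow>
   (nat \<Rightarrow> nat) \<Rightarrow> (nat \<Rightarrow> real) \<Rightarrow> (nat \<Rightarrow> real) \<Rightarrow> bool"
where
  "regime Cs \<beta> \<rho>\<^sub>1 \<rho>\<^sub>2 Kmax C K a b \<longleftrightarrow>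
     model \<beta> K a b \<and> constant_SNR \<rho>\<^sub>1 \<rho>\<^sub>2 a b \<and> envelope_whp C \<beta> K a b \<and>
     signal_entropy_separation Cs \<beta> K a b \<and> mild_growth K \<and>
     a \<in> o(\<lambda>n. real n) \<and> b \<in> o(\<lambda>n. real n) \<and> a \<in> \<Omega>(\<lambda>n. ln (real n)) \<and>
     (\<forall>\<^sub>F n in sequentially. K n \<le> Kmax)"

(* K log(nK) / (nI), the factor common to the feasibility condition and to B. *)
definition entropy_ratio :: "nat \<Rightarrow> nat \<Rightarrow> real \<Rightarrow> real \<Rightarrow> real" where
  "entropy_ratio n K a b = real K * ln (real (n * K)) / (real n * info n a b)"

end

theory Submission
  imports Defs "HOL-Real_Asymp.Real_Asymp"
begin

text \<open>Under the mechanism, the probability of an output \<open>\<sigma>\<close> is at most \<open>min 1 (exp (- \<eta> g))\<close>, where \<open>g\<close>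
  is the score gap between \<open>\<sigma>\<^sub>0\<close> and \<open>\<sigma>\<close>, hence at most \<open>exp (- \<theta> t\<^sup>\<star> g)\<close> for
  \<open>\<theta> = min 1 (\<eta> / t\<^sup>\<star>)\<close>. The exponential moment of \<open>g\<close> at \<open>t\<^sup>\<star>\<close> is explicit, so the mean of this
  bound over the random graph is at most \<open>exp (- \<theta> I W)\<close>, where \<open>W\<close> is a weighted number of pairs
  of vertices on which the two partitions disagree; and \<open>I W\<close> is at least
  \<open>(1 - o(1)) Signal\<close> per misclassified vertex as long as these are few. Summing over \<open>\<sigma>\<close>, the risk
  is at most a constant times \<open>exp (- (1 - o(1)) \<theta> Signal)\<close>. If \<open>\<theta> = 1\<close>, this is the statistical
  term. If \<open>\<theta> < 1\<close>, then either \<open>t\<^sup>\<star> s\<^sup>\<star>\<close> exceeds the exponent, and the claimed bound is at least 1, or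
  \<open>\<alpha>\<close> alone dominates the risk.\<close>

section \<open>Misclassified vertices and separated pairs\<close>

text \<open>A budget of order ln n only guarantees \<theta> Signal >= c ln n for a constant c that
  may lie below 1, whereas up to about (nK)^h labelings misclassify h vertices: a union bound for
  the event of any error need not be small. But only the mean loss is wanted. Small losses are free,
  since output probabilities sum to 1, and on the remaining labelings the count is controlled by the
  lower bound on h itself. This is why the threshold on the loss is proportional to the very bound
  being proved.

  The price is a factor Q depending on Kmax alone (the K! relabelings enter it). Since Signal >= ln
  n, it can be absorbed into the o(1); since Q <= n, also into the ln(nK) of s*. This explains the
  form of s*: as (\<eta> - B) s* = ln(nK) + ln(4/\<alpha>), an exponent of size \<eta> s* pushes Q
  times the exponential below \<alpha>.

  In this regime a, nI, Signal and \<Delta> agree up to constants, which makes the feasibility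
  condition logarithmic. The value 1 suffices for each of C_s, C_0, C_1, c_0 and c_1.\<close>

definition misfit :: "nat \<Rightarrow> (nat \<Rightarrow> nat) \<Rightarrow> (nat \<Rightarrow> nat) \<Rightarrow> nat" where
  "misfit n \<sigma> \<tau> = card {i \<in> {1..n}. \<sigma> i \<noteq> \<tau> i}"

text \<open>Not symmetric in its labelings: in the score gap between \<sigma> and \<tau>, the pairs
  of \<open>separated n \<sigma> \<tau>\<close> enter with sign +1, those of
  \<open>separated n \<tau> \<sigma>\<close> with sign -1, and all other pairs cancel.\<close>

definition separated :: "nat \<Rightarrow> (nat \<Rightarrow> nat) \<Rightarrow> (nat \<Rightarrow> nat) \<Rightarrow> nat" where
  "separated n \<sigma> \<tau> = card {(i, j) \<in> pairs n. \<sigma> i = \<sigma> j \<and> \<tau> i \<noteq> \<tau> j}"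

lemma finite_pairs [simp]: "finite (pairs n)"
  by (rule finite_subset[of _ "{1..n} \<times> {1..n}"]) (auto simp: pairs_def)

lemma misfit_le: "misfit n \<sigma> \<tau> \<le> n"
  unfolding misfit_def by (rule order_trans[OF card_mono[of "{1..n}"]]) auto

lemma misfit_commute: "misfit n \<sigma> \<tau> = misfit n \<tau> \<sigma>"
  unfolding misfit_def by (rule arg_cong[where f = card]) auto

lemma misfit_eq_sum: "real (misfit n \<sigma> \<tau>) = (\<Sum>i=1..n. of_bool (\<sigma> i \<noteq> \<tau> i))"
  unfolding misfit_def by (simp add: Int_def)

lemma misfit_permute_left:
  assumes "\<pi> permutes S"
  shows "misfit n (\<lambda>i. \<pi> (\<sigma> i)) \<tau> = misfit n \<sigma> (\<lambda>i. inv \<pi> (\<tau> i))"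
  unfolding misfit_def
  by (rule arg_cong[where f = card]) (use permutes_inverses[OF assms] in metis)

lemma separated_permute:
  assumes "\<pi> permutes S"
  shows "separated n \<sigma> (\<lambda>i. \<pi> (\<tau> i)) = separated n \<sigma> \<tau>"
    and "separated n (\<lambda>i. \<pi> (\<tau> i)) \<sigma> = separated n \<tau> \<sigma>"
  using permutes_inj[OF assms] unfolding separated_def by (simp_all add: inj_eq)

lemma loss_eq_misfit:
  "loss n K \<sigma> \<tau> = (MIN \<pi> \<in> {\<pi>. \<pi> permutes {1..K}}. real (misfit n \<sigma> (\<lambda>i. \<pi> (\<tau> i))) / real n)"
  unfolding loss_def misfit_eq_sum by simp

lemma loss_le:
  assumes "\<pi> permutes {1..K}"
  shows "loss n K \<sigma> \<tau> \<le> real (misfit n \<sigma> (\<lambda>i. \<pi> (\<tau> i))) / real n"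
  unfolding loss_eq_misfit using assms by (intro Min_le) (auto simp: finite_permutations)

lemma loss_attained:
  obtains \<pi> where "\<pi> permutes {1..K}" "loss n K \<sigma> \<tau> = real (misfit n \<sigma> (\<lambda>i. \<pi> (\<tau> i))) / real n"
proof -
  let ?P = "{\<pi>. \<pi> permutes {1..K}}"
  have "loss n K \<sigma> \<tau> \<in> (\<lambda>\<pi>. real (misfit n \<sigma> (\<lambda>i. \<pi> (\<tau> i))) / real n) ` ?P"
    unfolding loss_eq_misfit using permutes_id[of "{1..K}"]
    by (intro Min_in finite_imageI finite_permutations) (auto simp only: image_is_empty)
  then show ?thesis using that by auto
qed

lemma loss_nonneg: "0 \<le> loss n K \<sigma> \<tau>"
  by (rule loss_attained[of K n \<sigma> \<tau>]) simp

lemma loss_le_1: "loss n K \<sigma> \<tau> \<le> 1"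
proof (rule loss_attained[of K n \<sigma> \<tau>])
  fix \<pi> assume "loss n K \<sigma> \<tau> = real (misfit n \<sigma> (\<lambda>i. \<pi> (\<tau> i))) / real n"
  then show ?thesis using misfit_le[of n \<sigma> "\<lambda>i. \<pi> (\<tau> i)"] by (simp add: divide_le_eq)
qed

text \<open>\<open>pairs n\<close> holds only the representatives with \<open>i < j\<close>. Sorting
  an element of \<open>D \<times> E\<close> loses no information, because disjointness tells which
  entry came from \<open>D\<close>.\<close>

lemma card_cross_le:
  assumes "X \<subseteq> D \<times> E" "D \<inter> E = {}" "D \<subseteq> {1..n}" "E \<subseteq> {1..n}"
    and "\<And>i j. (i, j) \<in> X \<Longrightarrow> R i j" and "\<And>i j. R i j \<Longrightarrow> R j i"
  shows "card X \<le> card {(i, j) \<in> pairs n. R i j}"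
proof (rule card_inj_on_le)
  show "inj_on (\<lambda>(i, j). (min i j, max i j)) X"
  proof (rule inj_onI, clarify)
    fix i j i' j' assume *: "(i, j) \<in> X" "(i', j') \<in> X" "min i j = min i' j'" "max i j = max i' j'"
    then have "{i, j} = {i', j'}" by (auto simp: min_def max_def split: if_splits)
    then show "i = i' \<and> j = j'" using * assms(1,2) by (auto simp: doubleton_eq_iff)
  qed
  show "(\<lambda>(i, j). (min i j, max i j)) ` X \<subseteq> {(i, j) \<in> pairs n. R i j}"
  proof clarify
    fix i j assume X: "(i, j) \<in> X"
    then have "i \<in> {1..n}" "j \<in> {1..n}" "i \<noteq> j" using assms(1-4) by blast+
    moreover have "R i j" "R j i" using assms(5)[OF X] assms(6) by blast+
    ultimately show "(min i j, max i j) \<in> pairs n \<and> R (min i j) (max i j)"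
      by (auto simp: pairs_def min_def max_def)
  qed
  show "finite {(i, j) \<in> pairs n. R i j}"
    by (rule finite_subset[OF _ finite_pairs[of n]]) auto
qed

text \<open>A misclassified \<open>i\<close> is cut off by \<tau> from every correctly classified
  \<open>j\<close> of its own class, since then
  \<open>\<tau> j = \<sigma> j = \<sigma> i \<noteq> \<tau> i\<close>. Removing the misclassified
  vertices from a class of size at least \<open>s\<close> leaves enough such
  \<open>j\<close>.\<close>

lemma separated_ge_near:
  assumes "\<And>i. i \<in> {1..n} \<Longrightarrow> s \<le> real (card {j \<in> {1..n}. \<sigma> j = \<sigma> i})"
  shows "real (misfit n \<sigma> \<tau>) * (s - real (misfit n \<sigma> \<tau>)) \<le> real (separated n \<sigma> \<tau>)"
proof -
  define D where "D = {i \<in> {1..n}. \<sigma> i \<noteq> \<tau> i}"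
  define X where "X = (SIGMA i:D. {j \<in> {1..n} - D. \<sigma> j = \<sigma> i})"
  have D: "card D = misfit n \<sigma> \<tau>" "finite D" by (simp_all add: D_def misfit_def)
  have "s - real (card D) \<le> real (card {j \<in> {1..n} - D. \<sigma> j = \<sigma> i})" if "i \<in> D" for i
  proof -
    have "card {j \<in> {1..n}. \<sigma> j = \<sigma> i} \<le> card ({j \<in> {1..n} - D. \<sigma> j = \<sigma> i} \<union> D)"
      by (rule card_mono) (auto simp: D)
    also have "\<dots> \<le> card {j \<in> {1..n} - D. \<sigma> j = \<sigma> i} + card D" by (rule card_Un_le)
    finally show ?thesis using assms[of i] that by (simp add: D_def)
  qed
  then have "(\<Sum>i\<in>D. s - real (card D)) \<le> (\<Sum>i\<in>D. real (card {j \<in> {1..n} - D. \<sigma> j = \<sigma> i}))"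
    by (rule sum_mono)
  also have "\<dots> = real (card X)" unfolding X_def by (subst card_SigmaI) (auto simp: D)
  also have "card X \<le> separated n \<sigma> \<tau>" unfolding separated_def
    by (rule card_cross_le[of X D "{1..n} - D"]) (auto simp: X_def D_def)
  finally show ?thesis by (simp add: D)
qed

text \<open>With two labels, a misclassified and a correctly classified vertex share a class in
  exactly one of the two labelings, whatever the class sizes. So no factor \<beta> is lost, in
  accordance with \<open>Signal\<close> being nI/2 for K = 2.\<close>

lemma separated_sum_ge_two_classes:
  assumes "\<sigma> \<in> {1..n} \<rightarrow> {1..2}" "\<tau> \<in> {1..n} \<rightarrow> {1..2}"
  shows "misfit n \<sigma> \<tau> * (n - misfit n \<sigma> \<tau>) \<le> separated n \<sigma> \<tau> + separated n \<tau> \<sigma>"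
proof -
  define D where "D = {i \<in> {1..n}. \<sigma> i \<noteq> \<tau> i}"
  have D: "card D = misfit n \<sigma> \<tau>" "finite D" "D \<subseteq> {1..n}" by (auto simp: D_def misfit_def)
  have two: "\<sigma> i = 1 \<or> \<sigma> i = 2" "\<tau> i = 1 \<or> \<tau> i = 2" if "i \<in> {1..n}" for i
    using assms that by (force simp: Pi_iff)+
  have "card (D \<times> ({1..n} - D)) \<le> card {(i, j) \<in> pairs n. (\<sigma> i = \<sigma> j) \<noteq> (\<tau> i = \<tau> j)}"
  proof (rule card_cross_le[of _ D "{1..n} - D"])
    fix i j assume "(i, j) \<in> D \<times> ({1..n} - D)"
    then show "(\<sigma> i = \<sigma> j) \<noteq> (\<tau> i = \<tau> j)" using two[of i] two[of j] by (auto simp: D_def)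
  qed (auto simp: D_def)
  also have "{(i, j) \<in> pairs n. (\<sigma> i = \<sigma> j) \<noteq> (\<tau> i = \<tau> j)} =
      {(i, j) \<in> pairs n. \<sigma> i = \<sigma> j \<and> \<tau> i \<noteq> \<tau> j} \<union> {(i, j) \<in> pairs n. \<tau> i = \<tau> j \<and> \<sigma> i \<noteq> \<sigma> j}"
    by auto
  also have "card \<dots> \<le> separated n \<sigma> \<tau> + separated n \<tau> \<sigma>"
    unfolding separated_def by (rule card_Un_le)
  finally show ?thesis using D by (simp add: card_cartesian_product card_Diff_subset)
qed

text \<open>If few pairs are separated, then each class of \<open>\<sigma>\<close> lies almost entirely inside one class
  of \<open>\<tau>\<close>; since no class of \<open>\<tau>\<close> is small, the resulting map between labels is a permutation.\<close>

lemma separated_ge_far: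
  fixes \<beta> :: real
  assumes \<sigma>: "\<sigma> \<in> balanced n K \<beta>" and \<tau>: "\<tau> \<in> balanced n K \<beta>" and \<beta>: "1 \<le> \<beta>" and K: "1 \<le> K"
  shows "\<exists>\<pi>. \<pi> permutes {1..K} \<and>
    real n * real (misfit n (\<lambda>i. \<pi> (\<sigma> i)) \<tau>) \<le> \<beta>\<^sup>2 * real K ^ 4 * real (separated n \<sigma> \<tau>)"
proof (cases "n = 0")
  case True
  then show ?thesis using permutes_id by (auto intro!: exI[of _ id])
next
  case False
  define N where "N = real (separated n \<sigma> \<tau>)"
  have N0: "N \<ge> 0" by (simp add: N_def)
  \<comment> \<open>The confusion matrix of the two labelings; its marginals are the class
    sizes.\<close>
  define c where "c k l = real (card {i \<in> {1..n}. \<sigma> i = k \<and> \<tau> i = l})" for k l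
  have \<sigma>K: "\<sigma> i \<in> {1..K}" and \<tau>K: "\<tau> i \<in> {1..K}" if "i \<in> {1..n}" for i
    using that \<sigma> \<tau> by (auto simp: balanced_def PiE_iff)
  have row: "(\<Sum>l=1..K. c k l) = real (card {i \<in> {1..n}. \<sigma> i = k})" for k
  proof -
    have "{i \<in> {1..n}. \<sigma> i = k} = (\<Union>l\<in>{1..K}. {i \<in> {1..n}. \<sigma> i = k \<and> \<tau> i = l})"
      using \<tau>K by auto
    then show ?thesis unfolding c_def by (simp add: card_UN_disjoint disjoint_iff flip: of_nat_sum)
  qed
  have col: "(\<Sum>k=1..K. c k l) = real (card {i \<in> {1..n}. \<tau> i = l})" for l
  proof -
    have "{i \<in> {1..n}. \<tau> i = l} = (\<Union>k\<in>{1..K}. {i \<in> {1..n}. \<sigma> i = k \<and> \<tau> i = l})"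
      using \<sigma>K by auto
    then show ?thesis unfolding c_def by (simp add: card_UN_disjoint disjoint_iff flip: of_nat_sum)
  qed
  \<comment> \<open>Pigeonhole: a row sums to at least n/(\<beta>K) and has K entries.\<close>
  have "\<exists>l\<in>{1..K}. real n / (\<beta> * real K ^ 2) \<le> c k l" if k: "k \<in> {1..K}" for k
  proof (rule ccontr)
    assume "\<not> ?thesis"
    then have "(\<Sum>l=1..K. c k l) < (\<Sum>l=1..K. real n / (\<beta> * real K ^ 2))"
      using K by (intro sum_strict_mono) (auto simp: not_le)
    also have "\<dots> = real n / (\<beta> * real K)" using K by (simp add: power2_eq_square)
    finally have "real (card {i \<in> {1..n}. \<sigma> i = k}) < real n / (\<beta> * real K)" unfolding row .
    moreover have "real n / (\<beta> * real K) \<le> real (card {i \<in> {1..n}. \<sigma> i = k})"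
      using \<sigma> k unfolding balanced_def by blast
    ultimately show False by linarith
  qed
  then obtain f where f: "\<And>k. k \<in> {1..K} \<Longrightarrow> f k \<in> {1..K}"
    "\<And>k. k \<in> {1..K} \<Longrightarrow> real n / (\<beta> * real K ^ 2) \<le> c k (f k)" by metis
  have small: "real n * c k l \<le> \<beta> * real K ^ 2 * N" if k: "k \<in> {1..K}" and l: "l \<noteq> f k" for k l
  proof -
    \<comment> \<open>The product of two entries of one row counts pairs that \<tau> separates. The
      entry at \<open>f k\<close> is linear in n, so every other entry of the row is of order at
      most N/n.\<close>
    let ?D = "{i \<in> {1..n}. \<sigma> i = k \<and> \<tau> i = l}" and ?E = "{i \<in> {1..n}. \<sigma> i = k \<and> \<tau> i = f k}"
    have "card (?D \<times> ?E) \<le> separated n \<sigma> \<tau>" unfolding separated_def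
      by (rule card_cross_le[of _ ?D ?E]) (use l in auto)
    then have "c k l * c k (f k) \<le> N"
      by (simp add: c_def N_def card_cartesian_product flip: of_nat_mult)
    moreover have "c k l * (real n / (\<beta> * real K ^ 2)) \<le> c k l * c k (f k)"
      using f(2)[OF k] by (intro mult_left_mono) (auto simp: c_def)
    ultimately have "c k l * (real n / (\<beta> * real K ^ 2)) \<le> N" by linarith
    then show ?thesis using \<beta> K by (simp add: field_simps)
  qed
  have K4: "real K ^ 4 = real K ^ 2 * real K ^ 2" by (simp flip: power_add)
  show ?thesis
  proof (cases "f ` {1..K} = {1..K}")
    case True
    define \<pi> where "\<pi> x = (if x \<in> {1..K} then f x else x)" for x
    have "inj_on f {1..K}" using True by (intro eq_card_imp_inj_on) auto
    then have "bij_betw f {1..K} {1..K}" using True unfolding bij_betw_def by blast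
    then have "bij_betw \<pi> {1..K} {1..K}" by (subst bij_betw_cong[of _ _ f]) (simp_all add: \<pi>_def)
    then have perm: "\<pi> permutes {1..K}" by (rule bij_imp_permutes) (auto simp: \<pi>_def)
    have "{i \<in> {1..n}. \<pi> (\<sigma> i) \<noteq> \<tau> i} =
        (\<Union>k\<in>{1..K}. \<Union>l\<in>{1..K} - {f k}. {i \<in> {1..n}. \<sigma> i = k \<and> \<tau> i = l})"
      using \<sigma>K \<tau>K by (auto simp: \<pi>_def)
    then have "misfit n (\<lambda>i. \<pi> (\<sigma> i)) \<tau> \<le>
        (\<Sum>k\<in>{1..K}. card (\<Union>l\<in>{1..K} - {f k}. {i \<in> {1..n}. \<sigma> i = k \<and> \<tau> i = l}))"
      unfolding misfit_def by (simp add: card_UN_le)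
    also have "\<dots> \<le> (\<Sum>k\<in>{1..K}. \<Sum>l\<in>{1..K} - {f k}. card {i \<in> {1..n}. \<sigma> i = k \<and> \<tau> i = l})"
      by (intro sum_mono card_UN_le) auto
    finally have "real (misfit n (\<lambda>i. \<pi> (\<sigma> i)) \<tau>) \<le> (\<Sum>k\<in>{1..K}. \<Sum>l\<in>{1..K} - {f k}. c k l)"
      unfolding c_def by (simp flip: of_nat_sum)
    then have "real n * real (misfit n (\<lambda>i. \<pi> (\<sigma> i)) \<tau>)
        \<le> real n * (\<Sum>k\<in>{1..K}. \<Sum>l\<in>{1..K} - {f k}. c k l)"
      by (rule mult_left_mono) simp
    also have "\<dots> = (\<Sum>k\<in>{1..K}. \<Sum>l\<in>{1..K} - {f k}. real n * c k l)"
      by (simp add: sum_distrib_left)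
    also have "\<dots> \<le> (\<Sum>k\<in>{1..K}. \<Sum>l\<in>{1..K} - {f k}. \<beta> * real K ^ 2 * N)"
      by (intro sum_mono small) auto
    also have "\<dots> \<le> (\<Sum>k\<in>{1..K}. \<Sum>l\<in>{1..K}. \<beta> * real K ^ 2 * N)"
      using \<beta> N0 by (intro sum_mono sum_mono2) auto
    also have "\<dots> = \<beta> * (real K ^ 4 * N)" by (simp add: K4 power2_eq_square)
    also have "\<dots> \<le> \<beta>\<^sup>2 * (real K ^ 4 * N)"
      using \<beta> N0 by (intro mult_right_mono) (auto simp: power2_eq_square)
    finally show ?thesis using perm by (auto simp: N_def mult.assoc)
  next
    case False
    \<comment> \<open>This case is not contradictory. The missed class \<open>l\<close> of \<tau> is
      made of small entries only and still has linear size, so N is of order n^2, and the trivial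
      \<open>misfit \<le> n\<close> gives the claim for the identity permutation.\<close>
    then obtain l where l: "l \<in> {1..K}" "\<And>k. k \<in> {1..K} \<Longrightarrow> l \<noteq> f k" using f(1) by blast
    have "real n * (real n / (\<beta> * real K)) \<le> real n * (\<Sum>k=1..K. c k l)"
      unfolding col using \<tau> l(1) by (intro mult_left_mono) (auto simp: balanced_def)
    also have "\<dots> = (\<Sum>k=1..K. real n * c k l)" by (rule sum_distrib_left)
    also have "\<dots> \<le> (\<Sum>k=1..K. \<beta> * real K ^ 2 * N)" using l(2) by (intro sum_mono small) auto
    also have "\<dots> = real K * (\<beta> * real K ^ 2 * N)" by simp
    finally have "real n * real n \<le> \<beta> * real K * (real K * (\<beta> * real K ^ 2 * N))"
      using \<beta> K by (simp add: divide_le_eq mult.commute)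
    also have "\<dots> = \<beta>\<^sup>2 * real K ^ 4 * N" by (simp add: K4 power2_eq_square)
    finally have "real n * real (misfit n (\<lambda>i. id (\<sigma> i)) \<tau>) \<le> \<beta>\<^sup>2 * real K ^ 4 * N"
      using misfit_le[of n \<sigma> \<tau>] order_trans mult_left_mono[of "real (misfit n \<sigma> \<tau>)" "real n" "real n"]
      by fastforce
    then show ?thesis using permutes_id unfolding N_def by blast
  qed
qed

lemma loss_le_separated:
  fixes \<beta> :: real
  assumes "\<sigma> \<in> balanced n K \<beta>" "\<tau> \<in> balanced n K \<beta>" "1 \<le> \<beta>" "1 \<le> K" "0 < n"
  shows "real n * (real n * loss n K \<sigma> \<tau>) \<le> \<beta>\<^sup>2 * real K ^ 4 * real (separated n \<sigma> \<tau>)"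
    and "real n * (real n * loss n K \<sigma> \<tau>) \<le> \<beta>\<^sup>2 * real K ^ 4 * real (separated n \<tau> \<sigma>)"
proof -
  have *: "real n * (real n * loss n K \<sigma> \<tau>) \<le> x"
    if "\<pi> permutes {1..K}" "real n * real (misfit n \<sigma> (\<lambda>i. \<pi> (\<tau> i))) \<le> x" for \<pi> x
  proof -
    have "real n * loss n K \<sigma> \<tau> \<le> real (misfit n \<sigma> (\<lambda>i. \<pi> (\<tau> i)))"
      using loss_le[OF that(1), of n \<sigma> \<tau>] assms(5) by (simp add: field_simps)
    then have "real n * (real n * loss n K \<sigma> \<tau>) \<le> real n * real (misfit n \<sigma> (\<lambda>i. \<pi> (\<tau> i)))"
      by (rule mult_left_mono) simp
    then show ?thesis using that(2) by linarith
  qed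
  obtain \<pi> where \<pi>: "\<pi> permutes {1..K}"
    "real n * real (misfit n (\<lambda>i. \<pi> (\<sigma> i)) \<tau>) \<le> \<beta>\<^sup>2 * real K ^ 4 * real (separated n \<sigma> \<tau>)"
    using separated_ge_far[OF assms(1-4)] by blast
  show "real n * (real n * loss n K \<sigma> \<tau>) \<le> \<beta>\<^sup>2 * real K ^ 4 * real (separated n \<sigma> \<tau>)"
    using \<pi>(2) by (intro *[OF permutes_inv[OF \<pi>(1)]]) (simp add: misfit_permute_left[OF \<pi>(1)])
  obtain \<pi> where \<pi>: "\<pi> permutes {1..K}"
    "real n * real (misfit n (\<lambda>i. \<pi> (\<tau> i)) \<sigma>) \<le> \<beta>\<^sup>2 * real K ^ 4 * real (separated n \<tau> \<sigma>)"
    using separated_ge_far[OF assms(2,1,3,4)] by blast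
  show "real n * (real n * loss n K \<sigma> \<tau>) \<le> \<beta>\<^sup>2 * real K ^ 4 * real (separated n \<tau> \<sigma>)"
    using \<pi>(2) by (intro *[OF \<pi>(1)]) (simp add: misfit_commute)
qed

lemma balanced_class_ge:
  assumes "\<sigma> \<in> balanced n K \<beta>" "i \<in> {1..n}"
  shows "real n / (\<beta> * real K) \<le> real (card {j \<in> {1..n}. \<sigma> j = \<sigma> i})"
  using assms by (auto simp: balanced_def PiE_iff)

text \<open>An optimal relabeling of \<tau> turns the loss into a \<open>misfit\<close> and changes
  neither the separated pairs nor the class sizes available for the bounds above.\<close>

lemma loss_le_separated_near:
  fixes \<beta> :: real
  assumes "\<sigma> \<in> balanced n K \<beta>" "\<tau> \<in> balanced n K \<beta>" "0 < n"
  defines "h \<equiv> real n * loss n K \<sigma> \<tau>"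
  shows "h * (real n / (\<beta> * real K) - h) \<le> real (separated n \<sigma> \<tau>)"
    and "h * (real n / (\<beta> * real K) - h) \<le> real (separated n \<tau> \<sigma>)"
    and "K = 2 \<Longrightarrow> h * (real n - h) \<le> real (separated n \<sigma> \<tau>) + real (separated n \<tau> \<sigma>)"
proof -
  obtain \<pi> where \<pi>: "\<pi> permutes {1..K}"
    "loss n K \<sigma> \<tau> = real (misfit n \<sigma> (\<lambda>i. \<pi> (\<tau> i))) / real n" by (rule loss_attained)
  let ?\<tau> = "\<lambda>i. \<pi> (\<tau> i)"
  have h: "h = real (misfit n \<sigma> ?\<tau>)" using \<pi>(2) assms(3) by (simp add: h_def)
  show "h * (real n / (\<beta> * real K) - h) \<le> real (separated n \<sigma> \<tau>)"
    using separated_ge_near[OF balanced_class_ge[OF assms(1)], of ?\<tau>]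
    by (simp add: h separated_permute(1)[OF \<pi>(1)])
  have "real n / (\<beta> * real K) \<le> real (card {j \<in> {1..n}. ?\<tau> j = ?\<tau> i})" if "i \<in> {1..n}" for i
    using balanced_class_ge[OF assms(2) that] permutes_inj[OF \<pi>(1)] by (simp add: inj_eq)
  from separated_ge_near[OF this, of \<sigma>]
  show "h * (real n / (\<beta> * real K) - h) \<le> real (separated n \<tau> \<sigma>)"
    by (simp add: h separated_permute(2)[OF \<pi>(1)] misfit_commute)
  assume K: "K = 2"
  have "\<sigma> \<in> {1..n} \<rightarrow> {1..2}" "?\<tau> \<in> {1..n} \<rightarrow> {1..2}"
    using assms(1,2) permutes_in_image[OF \<pi>(1)] K by (auto simp: balanced_def PiE_iff Pi_iff)
  from separated_sum_ge_two_classes[OF this]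
  have "misfit n \<sigma> ?\<tau> * (n - misfit n \<sigma> ?\<tau>) \<le> separated n \<sigma> \<tau> + separated n \<tau> \<sigma>"
    by (simp add: separated_permute[OF \<pi>(1)])
  then have "real (misfit n \<sigma> ?\<tau> * (n - misfit n \<sigma> ?\<tau>)) \<le> real (separated n \<sigma> \<tau> + separated n \<tau> \<sigma>)"
    by (simp only: of_nat_le_iff)
  then show "h * (real n - h) \<le> real (separated n \<sigma> \<tau>) + real (separated n \<tau> \<sigma>)"
    using misfit_le[of n \<sigma> ?\<tau>] by (simp add: h of_nat_diff)
qed

section \<open>The exponential moment of the score gap\<close>

definition edge_weight :: "nat \<Rightarrow> real \<Rightarrow> real" where
  "edge_weight K w = (if K = 2 then 1 / 2 else w)"

text \<open>The exponent, in units of I, of the exponential moment of the score gap at t*. For K = 2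
  both weights are 1/2 and only the sum of the two counts matters.\<close>

definition weighted_separation ::
  "nat \<Rightarrow> nat \<Rightarrow> real \<Rightarrow> (nat \<Rightarrow> nat) \<Rightarrow> (nat \<Rightarrow> nat) \<Rightarrow> real" where
  "weighted_separation n K w \<sigma> \<tau> =
     (1 - edge_weight K w) * real (separated n \<sigma> \<tau>) + edge_weight K w * real (separated n \<tau> \<sigma>)"

lemma finite_set_SBM: "finite (set_pmf (SBM n a b \<sigma>))"
  unfolding SBM_def set_map_pmf
  by (intro finite_imageI finite_subset[OF set_Pi_pmf_subset'] finite_PiE_dflt) auto

lemma set_SBM_subset: "set_pmf (SBM n a b \<sigma>) \<subseteq> graphs n"
proof -
  have E: "1 \<le> i \<and> i < j \<and> i \<le> n \<and> 1 \<le> j \<and> j \<le> n"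
    if "E \<in> set_pmf (Pi_pmf (pairs n) False f)" "E (i, j)"
    for E i j and f :: "nat \<times> nat \<Rightarrow> bool pmf"
  proof -
    have "(i, j) \<in> pairs n" using that set_Pi_pmf_subset[OF finite_pairs, of n False f] by blast
    then show ?thesis by (auto simp: pairs_def)
  qed
  have "(\<lambda>i j. if i < j then E (i, j) else if j < i then E (j, i) else False) \<in> graphs n"
    if "E \<in> set_pmf (Pi_pmf (pairs n) False f)" for E and f :: "nat \<times> nat \<Rightarrow> bool pmf"
    unfolding graphs_def using E[OF that] by (auto dest: order.strict_trans2 split: if_splits)
  then show ?thesis unfolding SBM_def set_map_pmf by (rule image_subsetI)
qed

context
  fixes n :: nat and a b :: real
  assumes n: "0 < n" and ab: "0 < b" "b < a" "a < real n"
begin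

lemma prob_bounds: "0 < b / n" "b / n < a / n" "a / n < 1"
  using n ab by (auto simp: divide_simps)

lemma exp_tstar:
  "exp (tstar n a b) = sqrt (a / n * (1 - b / n)) / sqrt (b / n * (1 - a / n))"
proof -
  have "exp (tstar n a b) = sqrt (a * (1 - b / n) / (b * (1 - a / n)))"
  proof -
    have "0 < a * (1 - b / n) / (b * (1 - a / n))" using n ab prob_bounds by simp
    then show ?thesis unfolding tstar_def by (simp add: exp_ln flip: ln_sqrt)
  qed
  also have "a * (1 - b / n) / (b * (1 - a / n)) = (a / n * (1 - b / n)) / (b / n * (1 - a / n))"
    using n by simp
  finally show ?thesis by (simp add: real_sqrt_divide)
qed

lemma tstar_pos: "0 < tstar n a b"
proof -
  have "b / n * (1 - a / n) < a / n * (1 - b / n)" using prob_bounds by (simp add: algebra_simps)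
  moreover have "0 < b / n * (1 - a / n)" using prob_bounds by (intro mult_pos_pos) auto
  ultimately have "1 < exp (tstar n a b)"
    unfolding exp_tstar by (subst less_divide_eq_1_pos) (simp_all only: real_sqrt_gt_zero real_sqrt_less_iff)
  then show ?thesis by simp
qed

lemma mgf_factors_pos:
  "0 < a / n * exp (- tstar n a b) + 1 - a / n" "0 < b / n * exp (tstar n a b) + 1 - b / n"
  using prob_bounds by (smt (verit) exp_gt_zero mult_pos_pos)+

text \<open>At t* the cross terms p(1-q)e^(-t) and q(1-p)e^t of the expanded product coincide. The
  product is therefore the square of the Bhattacharyya coefficient of the two Bernoulli laws, and I
  is -2 times the logarithm of that coefficient.\<close>

lemma exp_info:
  "(a / n * exp (- tstar n a b) + 1 - a / n) * (b / n * exp (tstar n a b) + 1 - b / n)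
     = exp (- info n a b)"
proof -
  define p q where "p = a / n" and "q = b / n"
  have pq: "0 < q" "q < p" "p < 1" using prob_bounds by (simp_all add: p_def q_def)
  define x y where "x = sqrt (p * (1 - q))" and "y = sqrt (q * (1 - p))"
  have xy: "x > 0" "y > 0" "x * x = p * (1 - q)" "y * y = q * (1 - p)"
    using pq by (simp_all add: x_def y_def)
  have t: "exp (tstar n a b) = x / y" using exp_tstar by (simp add: x_def y_def p_def q_def)
  have "(p * exp (- tstar n a b) + 1 - p) * (q * exp (tstar n a b) + 1 - q)
      = p * q + (1 - p) * (1 - q) + (p * (1 - q)) * (y / x) + (q * (1 - p)) * (x / y)"
    unfolding exp_minus t using xy(1,2) by (simp add: field_simps)
  also have "\<dots> = p * q + (1 - p) * (1 - q) + 2 * (x * y)"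
    unfolding xy(3,4)[symmetric] using xy(1,2) by (simp add: field_simps)
  also have "x * y = sqrt (p * q) * sqrt ((1 - p) * (1 - q))"
    by (simp add: x_def y_def ac_simps flip: real_sqrt_mult)
  also have "p * q + (1 - p) * (1 - q) + 2 * (sqrt (p * q) * sqrt ((1 - p) * (1 - q)))
      = (sqrt (p * q) + sqrt ((1 - p) * (1 - q)))\<^sup>2"
    using pq by (simp add: power2_sum)
  also have "\<dots> = exp (- info n a b)"
  proof -
    have "0 < sqrt (p * q) + sqrt ((1 - p) * (1 - q))" using pq by (intro add_pos_pos) auto
    then show ?thesis by (simp add: info_def p_def q_def exp_double)
  qed
  finally show ?thesis by (simp add: p_def q_def)
qed

text \<open>The penalty \<open>\<lambda>\<close> is chosen so that, tilted by \<open>t\<^sup>\<star>\<close>, a separated pair contributes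
  exactly \<open>exp (-(1-w) I)\<close> or \<open>exp (-w I)\<close>.\<close>

lemma tilted_edge:
  fixes K :: nat and w :: real
  defines "t \<equiv> tstar n a b" and "l \<equiv> penalty n K w a b"
  shows "exp (t * l) * (a / n * exp (- t) + 1 - a / n) = exp (- (1 - edge_weight K w) * info n a b)"
    and "exp (- (t * l)) * (b / n * exp t + 1 - b / n) = exp (- edge_weight K w * info n a b)"
proof -
  define X Y where "X = a / n * exp (- t) + 1 - a / n" and "Y = b / n * exp t + 1 - b / n"
  have XY: "0 < X" "0 < Y" "X * Y = exp (- info n a b)"
    using mgf_factors_pos exp_info by (simp_all add: X_def Y_def t_def)
  have I: "ln X + ln Y = - info n a b" using XY by (metis ln_exp ln_mult_pos)
  have "t > 0" using tstar_pos by (simp add: t_def)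
  then have tl: "t * l = - edge_weight K w * ln X + (1 - edge_weight K w) * ln Y"
    unfolding l_def penalty_def Let_def edge_weight_def X_def Y_def t_def
    by (simp add: field_simps)
  have "exp (t * l) * X = exp (t * l + ln X)" using XY by (simp add: exp_add)
  also have "t * l + ln X = (1 - edge_weight K w) * (ln X + ln Y)" unfolding tl by algebra
  finally show "exp (t * l) * (a / n * exp (- t) + 1 - a / n) = exp (- (1 - edge_weight K w) * info n a b)"
    unfolding I by (simp only: X_def mult_minus_left mult_minus_right)
  have "exp (- (t * l)) * Y = exp (- (t * l) + ln Y)" using XY by (simp only: exp_add exp_ln)
  also have "- (t * l) + ln Y = edge_weight K w * (ln X + ln Y)" unfolding tl by algebra
  finally show "exp (- (t * l)) * (b / n * exp t + 1 - b / n) = exp (- edge_weight K w * info n a b)"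
    unfolding I by (simp only: Y_def mult_minus_left mult_minus_right)
qed

text \<open>The gap is a sum over independent edges, so the mean factorises into the tilted means of
  single edges. At t* this is an identity: nothing is lost before the union bound.\<close>

lemma expectation_exp_gap:
  fixes \<sigma> \<tau> :: "nat \<Rightarrow> nat" and K :: nat and w :: real
  defines "t \<equiv> tstar n a b" and "l \<equiv> penalty n K w a b"
  shows "measure_pmf.expectation (SBM n a b \<sigma>) (\<lambda>A. exp (- t * (score n l A \<sigma> - score n l A \<tau>)))
    = exp (- info n a b * weighted_separation n K w \<sigma> \<tau>)"
proof -
  define d :: "nat \<times> nat \<Rightarrow> real" where "d = (\<lambda>(i, j). of_bool (\<sigma> i = \<sigma> j) - of_bool (\<tau> i = \<tau> j))"
  define f where "f e x = exp (- t * ((of_bool x - l) * d e))" for e and x :: bool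
  define r where "r = (\<lambda>(i, j). if \<sigma> i = \<sigma> j then a / n else b / n)"
  define G where "G E i j = (if i < j then E (i, j) else if j < i then E (j, i) else False)"
    for E :: "nat \<times> nat \<Rightarrow> bool" and i j :: nat
  define v :: "nat \<times> nat \<Rightarrow> real" where "v = (\<lambda>(i, j). (1 - edge_weight K w) * of_bool (\<sigma> i = \<sigma> j \<and> \<tau> i \<noteq> \<tau> j)
      + edge_weight K w * of_bool (\<tau> i = \<tau> j \<and> \<sigma> i \<noteq> \<sigma> j))"
  have SBM: "SBM n a b \<sigma> = map_pmf G (Pi_pmf (pairs n) False (\<lambda>e. bernoulli_pmf (r e)))"
    unfolding SBM_def G_def[abs_def] r_def case_prod_unfold ..
  have gap: "exp (- t * (score n l (G E) \<sigma> - score n l (G E) \<tau>)) = (\<Prod>e\<in>pairs n. f e (E e))" for E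
  proof -
    have "score n l (G E) \<sigma> - score n l (G E) \<tau> = (\<Sum>e\<in>pairs n. (of_bool (E e) - l) * d e)"
      unfolding score_def sum_subtractf[symmetric]
      by (rule sum.cong) (auto simp: d_def G_def pairs_def algebra_simps)
    then show ?thesis by (simp add: f_def sum_distrib_left flip: exp_sum)
  qed
  have edge: "measure_pmf.expectation (bernoulli_pmf (r e)) (f e) = exp (- info n a b * v e)" for e
  proof -
    obtain i j where e: "e = (i, j)" by force
    have r01: "0 \<le> r e" "r e \<le> 1" using prob_bounds by (auto simp: r_def split: prod.splits)
    have E: "measure_pmf.expectation (bernoulli_pmf (r e)) (f e) = f e True * r e + f e False * (1 - r e)"
      using r01 by simp
    consider (same) "(\<sigma> i = \<sigma> j) = (\<tau> i = \<tau> j)" | (in1) "\<sigma> i = \<sigma> j" "\<tau> i \<noteq> \<tau> j"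
      | (in2) "\<tau> i = \<tau> j" "\<sigma> i \<noteq> \<sigma> j" by blast
    then show ?thesis
    proof cases
      case same
      then show ?thesis unfolding E by (simp add: f_def d_def v_def e)
    next
      case in1
      then have "f e True * r e + f e False * (1 - r e) = exp (t * l) * (a / n * exp (- t) + 1 - a / n)"
        by (simp add: f_def d_def r_def e algebra_simps flip: exp_add)
      then show ?thesis unfolding E using tilted_edge(1)[of K w] in1
        by (simp add: t_def l_def v_def e algebra_simps)
    next
      case in2
      then have "f e True * r e + f e False * (1 - r e) = exp (- (t * l)) * (b / n * exp t + 1 - b / n)"
        by (simp add: f_def d_def r_def e algebra_simps flip: exp_add)
      then show ?thesis unfolding E using tilted_edge(2)[of K w] in2
        by (simp add: t_def l_def v_def e algebra_simps)
    qed
  qed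
  have "measure_pmf.expectation (SBM n a b \<sigma>) (\<lambda>A. exp (- t * (score n l A \<sigma> - score n l A \<tau>)))
      = measure_pmf.expectation (Pi_pmf (pairs n) False (\<lambda>e. bernoulli_pmf (r e)))
          (\<lambda>E. \<Prod>e\<in>pairs n. f e (E e))"
    unfolding SBM integral_map_pmf gap ..
  also have "\<dots> = (\<Prod>e\<in>pairs n. measure_pmf.expectation (bernoulli_pmf (r e)) (f e))"
    by (rule expectation_prod_Pi_pmf) (auto simp: f_def intro: integrable_measure_pmf_finite)
  also have "\<dots> = exp (\<Sum>e\<in>pairs n. - info n a b * v e)"
    unfolding edge by (simp add: exp_sum)
  also have "(\<Sum>e\<in>pairs n. - info n a b * v e) = - info n a b * (\<Sum>e\<in>pairs n. v e)"
    by (simp add: sum_distrib_left)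
  also have "(\<Sum>e\<in>pairs n. v e) = weighted_separation n K w \<sigma> \<tau>"
    unfolding v_def weighted_separation_def separated_def case_prod_unfold sum.distrib
      sum_distrib_left[symmetric] by (simp add: Int_def)
  finally show ?thesis .
qed

text \<open>Young's inequality in the form \<open>e\<^sup>\<theta>\<^sup>v \<le> e\<^sup>\<theta>\<^sup>y (1 - \<theta> + \<theta> e\<^sup>v\<^sup>-\<^sup>y)\<close> replaces
  Jensen's inequality.\<close>

lemma expectation_exp_gap_le:
  fixes \<sigma> \<tau> :: "nat \<Rightarrow> nat" and K :: nat and w \<theta> :: real
  assumes \<theta>: "0 \<le> \<theta>" "\<theta> \<le> 1"
  defines "t \<equiv> tstar n a b" and "l \<equiv> penalty n K w a b"
  shows "measure_pmf.expectation (SBM n a b \<sigma>)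
      (\<lambda>A. exp (- (\<theta> * t) * (score n l A \<sigma> - score n l A \<tau>)))
    \<le> exp (- \<theta> * (info n a b * weighted_separation n K w \<sigma> \<tau>))"
proof -
  define y where "y = - info n a b * weighted_separation n K w \<sigma> \<tau>"
  define g where "g A = - t * (score n l A \<sigma> - score n l A \<tau>)" for A
  \<comment> \<open>Convexity of exp between 0 and \<open>g A - y\<close>. Since \<open>y\<close> is
    the logarithm of the mean of \<open>exp (g A)\<close>, the right-hand side has mean exactly
    \<open>exp (\<theta> * y)\<close>.\<close>
  have young: "exp (\<theta> * g A) \<le> exp (\<theta> * y) * (1 - \<theta>) + (exp (\<theta> * y) * \<theta> * exp (- y)) * exp (g A)" for A
  proof -
    have "exp ((1 - \<theta>) *\<^sub>R 0 + \<theta> *\<^sub>R (g A - y)) \<le> (1 - \<theta>) * exp 0 + \<theta> * exp (g A - y)"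
      using \<theta> by (intro convex_onD[OF exp_convex]) auto
    then have "exp (\<theta> * y) * exp (\<theta> * (g A - y)) \<le> exp (\<theta> * y) * ((1 - \<theta>) + \<theta> * exp (g A - y))"
      by (intro mult_left_mono) auto
    moreover have "exp (\<theta> * y) * exp (\<theta> * (g A - y)) = exp (\<theta> * g A)"
      by (simp add: algebra_simps flip: exp_add)
    moreover have "exp (g A - y) = exp (- y) * exp (g A)" by (simp flip: exp_add)
    ultimately show ?thesis by (simp add: distrib_left mult.assoc)
  qed
  have int: "integrable (measure_pmf (SBM n a b \<sigma>)) h" for h :: "graph \<Rightarrow> real"
    by (rule integrable_measure_pmf_finite[OF finite_set_SBM])
  have "measure_pmf.expectation (SBM n a b \<sigma>) (\<lambda>A. exp (\<theta> * g A))
      \<le> measure_pmf.expectation (SBM n a b \<sigma>)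
          (\<lambda>A. exp (\<theta> * y) * (1 - \<theta>) + (exp (\<theta> * y) * \<theta> * exp (- y)) * exp (g A))"
    by (intro integral_mono int young)
  also have "\<dots> = exp (\<theta> * y) * (1 - \<theta>) + (exp (\<theta> * y) * \<theta> * exp (- y))
      * measure_pmf.expectation (SBM n a b \<sigma>) (\<lambda>A. exp (g A))"
    by (subst Bochner_Integration.integral_add) (auto simp: int)
  also have "measure_pmf.expectation (SBM n a b \<sigma>) (\<lambda>A. exp (g A)) = exp y"
    using expectation_exp_gap[where \<sigma> = \<sigma> and \<tau> = \<tau> and K = K and w = w]
    by (simp add: g_def y_def t_def l_def)
  also have "exp (\<theta> * y) * (1 - \<theta>) + (exp (\<theta> * y) * \<theta> * exp (- y)) * exp y = exp (\<theta> * y)"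
    by (simp add: exp_minus field_simps)
  finally show ?thesis by (simp add: g_def y_def mult.assoc)
qed

end

section \<open>The risk of a private extension\<close>

lemma power_misfit: "v ^ misfit n \<sigma> \<tau> = (\<Prod>j=1..n. if \<sigma> j \<noteq> \<tau> j then v else (1::real))"
proof -
  have "(\<Prod>j=1..n. if \<sigma> j \<noteq> \<tau> j then v else 1) = (\<Prod>j\<in>{j\<in>{1..n}. \<sigma> j \<noteq> \<tau> j}. v)"
    by (rule prod.inter_filter[symmetric]) simp
  then show ?thesis by (simp add: misfit_def)
qed

text \<open>Without the factor \<open>misfit\<close>, the sum would be a product over vertices with
  factors at most 1 + Kv. Writing \<open>misfit\<close> as a sum of indicators keeps the product
  form for each \<open>i\<close>, but forces vertex \<open>i\<close> to be wrong, so that its factor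
  is at most Kv.\<close>

lemma sum_misfit_power_le:
  assumes v: "0 \<le> (v::real)"
  shows "(\<Sum>\<tau>\<in>{1..n} \<rightarrow>\<^sub>E {1..K}. real (misfit n \<sigma> \<tau>) * v ^ misfit n \<sigma> \<tau>)
    \<le> real n * (real K * v * exp (real n * (real K * v)))"
proof -
  let ?P = "{1..n} \<rightarrow>\<^sub>E {1..K}"
  define z where "z = real K * v"
  have z: "z \<ge> 0" using v by (simp add: z_def)
  \<comment> \<open>The weight of label \<open>k\<close> at vertex \<open>j\<close>; giving the
    correct label weight 0 at \<open>j = i\<close> encodes the indicator that \<open>i\<close> is
    misclassified.\<close>
  define g where "g i j k = (if \<sigma> j \<noteq> k then v else if j = i then 0 else (1::real))" for i j k
  have g0: "g i j k \<ge> 0" for i j k using v by (simp add: g_def)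
  have split: "of_bool (\<sigma> i \<noteq> \<tau> i) * v ^ misfit n \<sigma> \<tau> = (\<Prod>j=1..n. g i j (\<tau> j))" if i: "i \<in> {1..n}" for i \<tau>
  proof (cases "\<sigma> i = \<tau> i")
    case True
    then have "(\<Prod>j=1..n. g i j (\<tau> j)) = 0" using i by (intro prod_zero) (auto simp: g_def)
    then show ?thesis using True by simp
  next
    case False
    then show ?thesis unfolding power_misfit by (auto simp: g_def intro!: prod.cong)
  qed
  have gsum: "(\<Sum>k=1..K. g i j k) \<le> (if j = i then z else 1 + z)" for i j
  proof -
    have "(\<Sum>k=1..K. g i j k) \<le> (\<Sum>k=1..K. v + of_bool (\<sigma> j = k \<and> j \<noteq> i))"
      using v by (intro sum_mono) (auto simp: g_def)
    also have "\<dots> = z + (\<Sum>k=1..K. of_bool (\<sigma> j = k \<and> j \<noteq> i))" by (simp add: sum.distrib z_def)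
    also have "(\<Sum>k=1..K. of_bool (\<sigma> j = k \<and> j \<noteq> i)) \<le> (of_bool (j \<noteq> i) :: real)"
      by (cases "j = i") (simp_all add: of_bool_def sum.delta)
    finally show ?thesis by (auto split: if_splits)
  qed
  have one: "(\<Sum>\<tau>\<in>?P. of_bool (\<sigma> i \<noteq> \<tau> i) * v ^ misfit n \<sigma> \<tau>) \<le> z * exp (real n * z)"
    if i: "i \<in> {1..n}" for i
  proof -
    have "(\<Sum>\<tau>\<in>?P. of_bool (\<sigma> i \<noteq> \<tau> i) * v ^ misfit n \<sigma> \<tau>) = (\<Sum>\<tau>\<in>?P. \<Prod>j=1..n. g i j (\<tau> j))"
      by (rule sum.cong[OF refl split[OF i]])
    also have "\<dots> = (\<Prod>j=1..n. \<Sum>k=1..K. g i j k)" by (subst prod_sum_PiE) auto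
    also have "\<dots> \<le> (\<Prod>j=1..n. if j = i then z else 1 + z)"
      using gsum g0 by (intro prod_mono) (simp add: sum_nonneg)
    also have "\<dots> = z * (\<Prod>j\<in>{1..n} - {i}. if j = i then z else 1 + z)"
      using i by (subst prod.remove[of _ i]) auto
    also have "(\<Prod>j\<in>{1..n} - {i}. if j = i then z else 1 + z) = (1 + z) ^ (n - 1)"
      using i by (subst prod.cong[OF refl, of _ _ "\<lambda>_. 1 + z"]) auto
    also have "(1 + z) ^ (n - 1) \<le> exp z ^ n"
    proof -
      have "(1 + z) ^ (n - 1) \<le> (1 + z) ^ n" using z by (intro power_increasing) auto
      also have "\<dots> \<le> exp z ^ n" using z exp_ge_add_one_self by (intro power_mono) auto
      finally show ?thesis .
    qed
    finally show ?thesis using z by (simp add: mult_left_mono exp_of_nat_mult)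
  qed
  have "(\<Sum>\<tau>\<in>?P. real (misfit n \<sigma> \<tau>) * v ^ misfit n \<sigma> \<tau>)
      = (\<Sum>\<tau>\<in>?P. \<Sum>i=1..n. of_bool (\<sigma> i \<noteq> \<tau> i) * v ^ misfit n \<sigma> \<tau>)"
    unfolding misfit_eq_sum by (simp only: sum_distrib_right)
  also have "\<dots> = (\<Sum>i=1..n. \<Sum>\<tau>\<in>?P. of_bool (\<sigma> i \<noteq> \<tau> i) * v ^ misfit n \<sigma> \<tau>)"
    by (rule sum.swap)
  also have "\<dots> \<le> (\<Sum>i=1..n. z * exp (real n * z))" by (intro sum_mono one)
  finally show ?thesis by (simp add: z_def)
qed

lemma finite_balanced: "finite (balanced n K \<beta>)"
  by (rule finite_subset[of _ "{1..n} \<rightarrow>\<^sub>E {1..K}"]) (auto simp: balanced_def intro: finite_PiE)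

lemma card_balanced_le: "real (card (balanced n K \<beta>)) \<le> real K ^ n"
proof -
  have "card (balanced n K \<beta>) \<le> card ({1..n} \<rightarrow>\<^sub>E {1..K})"
    by (rule card_mono) (auto simp: balanced_def intro: finite_PiE)
  also have "\<dots> = K ^ n" by (simp add: card_PiE)
  finally show ?thesis by (simp flip: of_nat_power)
qed

text \<open>The permutation behind \<open>m \<tau>\<close> may depend on \<tau>. Summing over all
  permutations removes the dependence at the cost of K!, and for a fixed one relabeling is injective
  on labelings.\<close>

lemma sum_misfit_permuted_le:
  assumes v: "0 \<le> (v::real)"
    and m: "\<And>\<tau>. \<tau> \<in> balanced n K \<beta> \<Longrightarrow> \<exists>\<pi>. \<pi> permutes {1..K} \<and> m \<tau> = misfit n \<sigma> (\<lambda>i. \<pi> (\<tau> i))"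
  shows "(\<Sum>\<tau>\<in>balanced n K \<beta>. real (m \<tau>) * v ^ m \<tau>)
    \<le> fact K * (real n * (real K * v * exp (real n * (real K * v))))"
proof -
  let ?P = "{1..n} \<rightarrow>\<^sub>E {1..K}" and ?S = "{\<pi>. \<pi> permutes {1..K}}"
  define f where "f h = real h * v ^ h" for h
  have f0: "f h \<ge> 0" for h using v by (simp add: f_def)
  have finS: "finite ?S" by (simp add: finite_permutations)
  have "(\<Sum>\<tau>\<in>balanced n K \<beta>. f (m \<tau>))
      \<le> (\<Sum>\<tau>\<in>balanced n K \<beta>. \<Sum>\<pi>\<in>?S. f (misfit n \<sigma> (\<lambda>i. \<pi> (\<tau> i))))"
  proof (rule sum_mono)
    fix \<tau> assume "\<tau> \<in> balanced n K \<beta>"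
    then obtain \<pi> where "\<pi> \<in> ?S" "m \<tau> = misfit n \<sigma> (\<lambda>i. \<pi> (\<tau> i))" using m by blast
    then show "f (m \<tau>) \<le> (\<Sum>\<pi>\<in>?S. f (misfit n \<sigma> (\<lambda>i. \<pi> (\<tau> i))))"
      using member_le_sum[OF _ _ finS, of \<pi> "\<lambda>\<pi>. f (misfit n \<sigma> (\<lambda>i. \<pi> (\<tau> i)))"] f0 by auto
  qed
  also have "\<dots> \<le> (\<Sum>\<tau>\<in>?P. \<Sum>\<pi>\<in>?S. f (misfit n \<sigma> (\<lambda>i. \<pi> (\<tau> i))))"
    by (rule sum_mono2) (auto simp: balanced_def f0 sum_nonneg intro: finite_PiE)
  also have "\<dots> = (\<Sum>\<pi>\<in>?S. \<Sum>\<tau>\<in>?P. f (misfit n \<sigma> (\<lambda>i. \<pi> (\<tau> i))))" by (rule sum.swap)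
  also have "\<dots> \<le> (\<Sum>\<pi>\<in>?S. \<Sum>\<tau>\<in>?P. f (misfit n \<sigma> \<tau>))"
  proof (rule sum_mono)
    fix \<pi> assume "\<pi> \<in> ?S"
    then have \<pi>: "\<pi> permutes {1..K}" by simp
    \<comment> \<open>The restriction keeps the relabeled function extensional: a permutation might
      move the default value taken outside of \<open>{1..n}\<close>.\<close>
    define \<phi> where "\<phi> \<tau> = restrict (\<lambda>i. \<pi> (\<tau> i)) {1..n}" for \<tau> :: "nat \<Rightarrow> nat"
    have inj: "inj_on \<phi> ?P"
    proof (rule inj_onI)
      fix \<tau> \<tau>' assume *: "\<tau> \<in> ?P" "\<tau>' \<in> ?P" "\<phi> \<tau> = \<phi> \<tau>'"
      have "\<tau> i = \<tau>' i" if "i \<in> {1..n}" for i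
        using fun_cong[OF *(3), of i] that permutes_inj[OF \<pi>] by (simp add: \<phi>_def inj_eq)
      with *(1,2) show "\<tau> = \<tau>'" by (rule PiE_ext)
    qed
    have "(\<Sum>\<tau>\<in>?P. f (misfit n \<sigma> (\<lambda>i. \<pi> (\<tau> i)))) = (\<Sum>\<tau>\<in>?P. f (misfit n \<sigma> (\<phi> \<tau>)))"
      by (intro sum.cong refl arg_cong[where f = f])
        (auto simp: misfit_def \<phi>_def intro!: arg_cong[where f = card])
    also have "\<dots> = (\<Sum>\<tau>\<in>\<phi> ` ?P. f (misfit n \<sigma> \<tau>))" by (simp only: sum.reindex[OF inj] o_def)
    also have "\<dots> \<le> (\<Sum>\<tau>\<in>?P. f (misfit n \<sigma> \<tau>))"
      using permutes_in_image[OF \<pi>]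
      by (intro sum_mono2 f0 finite_PiE) (auto simp: \<phi>_def PiE_iff extensional_def)
    finally show "(\<Sum>\<tau>\<in>?P. f (misfit n \<sigma> (\<lambda>i. \<pi> (\<tau> i)))) \<le> (\<Sum>\<tau>\<in>?P. f (misfit n \<sigma> \<tau>))" .
  qed
  also have "\<dots> = fact K * (\<Sum>\<tau>\<in>?P. f (misfit n \<sigma> \<tau>))"
  proof -
    have "card ?S = fact K" by (rule card_permutations) simp_all
    then show ?thesis by (simp only: sum_constant of_nat_fact)
  qed
  also have "\<dots> \<le> fact K * (real n * (real K * v * exp (real n * (real K * v))))"
    unfolding f_def by (intro mult_left_mono sum_misfit_power_le v) auto
  finally show ?thesis by (simp add: f_def)
qed

text \<open>Discarding the labelings of loss below \<open>x = e K u\<close> pays for the factor \<open>n\<close> in the union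
  bound: on the rest, \<open>u\<^sup>h \<le> (e u)\<^sup>h e\<^sup>-\<^sup>n\<^sup>x\<close>.\<close>

lemma sum_loss_le:
  fixes J :: "(nat \<Rightarrow> nat) \<Rightarrow> real"
  assumes n: "0 < n"
    and near: "\<And>\<tau>. \<tau> \<in> balanced n K \<beta> \<Longrightarrow> loss n K \<sigma> \<tau> \<le> \<gamma> \<Longrightarrow> real n * loss n K \<sigma> \<tau> * A \<le> J \<tau>"
    and far: "\<And>\<tau>. \<tau> \<in> balanced n K \<beta> \<Longrightarrow> \<gamma> < loss n K \<sigma> \<tau> \<Longrightarrow> F \<le> J \<tau>"
  defines "x \<equiv> exp 1 * (real K * exp (- A))"
  shows "(\<Sum>\<tau> | \<tau> \<in> balanced n K \<beta> \<and> x < loss n K \<sigma> \<tau>. loss n K \<sigma> \<tau> * exp (- J \<tau>))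
    \<le> fact K * x + real K ^ n * exp (- F)"
proof -
  let ?B = "balanced n K \<beta>"
  define v where "v = exp (1 - A)"
  have x: "x = real K * v" by (simp add: x_def v_def exp_diff exp_minus field_simps)
  have "\<forall>\<tau>. \<exists>h. (\<exists>\<pi>. \<pi> permutes {1..K} \<and> h = misfit n \<sigma> (\<lambda>i. \<pi> (\<tau> i))) \<and> loss n K \<sigma> \<tau> = real h / real n"
  proof
    fix \<tau> show "\<exists>h. (\<exists>\<pi>. \<pi> permutes {1..K} \<and> h = misfit n \<sigma> (\<lambda>i. \<pi> (\<tau> i))) \<and> loss n K \<sigma> \<tau> = real h / real n"
      by (rule loss_attained[of K n \<sigma> \<tau>]) blast
  qed
  from choice[OF this] obtain m where
    "\<forall>\<tau>. (\<exists>\<pi>. \<pi> permutes {1..K} \<and> m \<tau> = misfit n \<sigma> (\<lambda>i. \<pi> (\<tau> i))) \<and> loss n K \<sigma> \<tau> = real (m \<tau>) / real n"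
    by blast
  then have m: "\<exists>\<pi>. \<pi> permutes {1..K} \<and> m \<tau> = misfit n \<sigma> (\<lambda>i. \<pi> (\<tau> i))"
    and loss: "loss n K \<sigma> \<tau> = real (m \<tau>) / real n" for \<tau> by blast+
  have "(\<Sum>\<tau> | \<tau> \<in> ?B \<and> x < loss n K \<sigma> \<tau>. loss n K \<sigma> \<tau> * exp (- J \<tau>))
      \<le> (\<Sum>\<tau> | \<tau> \<in> ?B \<and> x < loss n K \<sigma> \<tau>.
            exp (- (real n * x)) / real n * (real (m \<tau>) * v ^ m \<tau>) + exp (- F))"
  proof (rule sum_mono)
    fix \<tau> assume "\<tau> \<in> {\<tau>. \<tau> \<in> ?B \<and> x < loss n K \<sigma> \<tau>}"
    then have \<tau>: "\<tau> \<in> ?B" "x < loss n K \<sigma> \<tau>" by auto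
    have pos: "0 \<le> exp (- (real n * x)) / real n * (real (m \<tau>) * v ^ m \<tau>)" by (simp add: v_def)
    show "loss n K \<sigma> \<tau> * exp (- J \<tau>)
        \<le> exp (- (real n * x)) / real n * (real (m \<tau>) * v ^ m \<tau>) + exp (- F)"
    proof (cases "loss n K \<sigma> \<tau> \<le> \<gamma>")
      case True
      have nx: "real n * x \<le> real (m \<tau>)" using \<tau>(2) n by (simp add: loss field_simps)
      have "exp (- J \<tau>) \<le> exp (- (real (m \<tau>) * A))" using near[OF \<tau>(1) True] n by (simp add: loss)
      also have "\<dots> \<le> exp (real (m \<tau>) * (1 - A) + - (real n * x))"
        using nx by (simp add: algebra_simps)
      also have "\<dots> = exp (- (real n * x)) * v ^ m \<tau>"
        unfolding exp_add by (simp add: v_def mult.commute flip: exp_of_nat_mult)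
      finally have "loss n K \<sigma> \<tau> * exp (- J \<tau>) \<le> loss n K \<sigma> \<tau> * (exp (- (real n * x)) * v ^ m \<tau>)"
        by (intro mult_left_mono loss_nonneg)
      also have "\<dots> = exp (- (real n * x)) / real n * (real (m \<tau>) * v ^ m \<tau>)" by (simp add: loss)
      finally show ?thesis by (simp add: add_increasing2)
    next
      case False
      then have "exp (- J \<tau>) \<le> exp (- F)" using far[OF \<tau>(1)] by simp
      then have "loss n K \<sigma> \<tau> * exp (- J \<tau>) \<le> 1 * exp (- F)"
        by (intro mult_mono loss_le_1) auto
      then show ?thesis using pos by linarith
    qed
  qed
  also have "\<dots> \<le> (\<Sum>\<tau>\<in>?B. exp (- (real n * x)) / real n * (real (m \<tau>) * v ^ m \<tau>) + exp (- F))"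
    by (rule sum_mono2) (auto simp: finite_balanced v_def intro!: add_nonneg_nonneg)
  also have "\<dots> = exp (- (real n * x)) / real n * (\<Sum>\<tau>\<in>?B. real (m \<tau>) * v ^ m \<tau>) + real (card ?B) * exp (- F)"
    by (simp add: sum.distrib sum_distrib_left)
  also have "\<dots> \<le> exp (- (real n * x)) / real n * (fact K * (real n * (real K * v * exp (real n * (real K * v)))))
      + real K ^ n * exp (- F)"
    by (intro add_mono mult_left_mono mult_right_mono sum_misfit_permuted_le[where \<sigma> = \<sigma>] card_balanced_le m)
      (auto simp: v_def)
  \<comment> \<open>As x = Kv, the growth \<open>exp (real n * (real K * v))\<close> of the counting
    bound cancels \<open>exp (- (real n * x))\<close>, and its factor n cancels the 1/n in the
    loss.\<close>
  also have "\<dots> = fact K * x + real K ^ n * exp (- F)"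
    unfolding x[symmetric] using n by (simp add: exp_minus field_simps)
  finally show ?thesis .
qed

text \<open>The normaliser is at least the weight of the truth \<sigma>, so no entropy term appears
  here. The rate is \<eta> = \<epsilon>/(4\<Delta>), which is
  \<open>\<epsilon>0 / (2 * sens n C a)\<close> with
  \<open>\<epsilon>0 = \<epsilon> / 2\<close>.\<close>

lemma pmf_private_extension_le:
  assumes M: "private_extension n K \<beta> w C a b \<epsilon> M" and A: "A \<in> envelope n C a"
    and \<sigma>: "\<sigma> \<in> balanced n K \<beta>" and \<tau>: "\<tau> \<in> balanced n K \<beta>"
  defines "T \<equiv> score n (penalty n K w a b) A"
  shows "pmf (M A) \<tau> \<le> exp (- (\<epsilon> / (4 * sens n C a)) * (T \<sigma> - T \<tau>))"
proof -
  define \<eta> where "\<eta> = \<epsilon> / (4 * sens n C a)"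
  define Z where "Z = (\<Sum>\<tau>\<in>balanced n K \<beta>. exp (\<eta> * T \<tau>))"
  have "exp (\<eta> * T \<sigma>) \<le> Z" unfolding Z_def
    using \<sigma> by (intro member_le_sum) (auto simp: finite_balanced)
  moreover have "pmf (M A) \<tau> = exp (\<eta> * T \<tau>) / Z"
    using M A \<tau> unfolding private_extension_def exp_mech_prob_def Let_def Z_def \<eta>_def T_def
    by (simp add: mult.commute)
  ultimately have "pmf (M A) \<tau> \<le> exp (\<eta> * T \<tau>) / exp (\<eta> * T \<sigma>)"
    by (auto intro!: divide_left_mono mult_pos_pos intro: less_le_trans[of 0 "exp (\<eta> * T \<sigma>)"])
  also have "\<dots> = exp (- \<eta> * (T \<sigma> - T \<tau>))" by (simp add: algebra_simps flip: exp_diff)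
  finally show ?thesis by (simp add: \<eta>_def)
qed

section \<open>The risk as a sum over labelings\<close>

lemma risk_eq:
  assumes "private_extension n K \<beta> w C a b \<epsilon> M"
  shows "risk n K a b \<sigma> M =
    measure_pmf.expectation (SBM n a b \<sigma>) (\<lambda>A. measure_pmf.expectation (M A) (loss n K \<sigma>))"
proof -
  let ?G = "set_pmf (SBM n a b \<sigma>)"
  have fin: "finite ?G" by (rule finite_set_SBM)
  have "finite (set_pmf (M A))" if "A \<in> ?G" for A
    using that assms set_SBM_subset[of n a b \<sigma>] finite_subset[OF _ finite_balanced]
    unfolding private_extension_def by blast
  then have "risk n K a b \<sigma> M =
      (\<Sum>A\<in>?G. pmf (SBM n a b \<sigma>) A *\<^sub>R measure_pmf.expectation (M A) (loss n K \<sigma>))"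
    unfolding risk_def by (intro pmf_expectation_bind fin) auto
  also have "\<dots> = measure_pmf.expectation (SBM n a b \<sigma>) (\<lambda>A. measure_pmf.expectation (M A) (loss n K \<sigma>))"
    using fin by (subst integral_measure_pmf[of ?G]) auto
  finally show ?thesis .
qed

lemma expectation_loss_eq:
  assumes "private_extension n K \<beta> w C a b \<epsilon> M" "A \<in> graphs n"
  shows "measure_pmf.expectation (M A) (loss n K \<sigma>) = (\<Sum>\<tau>\<in>balanced n K \<beta>. loss n K \<sigma> \<tau> * pmf (M A) \<tau>)"
  using assms unfolding private_extension_def
  by (intro integral_measure_pmf_real finite_balanced) blast

lemma sum_pmf_balanced:
  assumes "private_extension n K \<beta> w C a b \<epsilon> M" "A \<in> graphs n"
  shows "(\<Sum>\<tau>\<in>balanced n K \<beta>. pmf (M A) \<tau>) = 1"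
  using assms unfolding private_extension_def by (intro sum_pmf_eq_1 finite_balanced) blast

lemma expectation_loss_le_1:
  assumes "private_extension n K \<beta> w C a b \<epsilon> M" "A \<in> graphs n"
  shows "measure_pmf.expectation (M A) (loss n K \<sigma>) \<le> 1"
proof -
  have "(\<Sum>\<tau>\<in>balanced n K \<beta>. loss n K \<sigma> \<tau> * pmf (M A) \<tau>) \<le> (\<Sum>\<tau>\<in>balanced n K \<beta>. 1 * pmf (M A) \<tau>)"
    by (intro sum_mono mult_right_mono loss_le_1) simp
  then show ?thesis using assms by (simp add: expectation_loss_eq sum_pmf_balanced)
qed

context
  fixes n :: nat and a b :: real
  assumes n: "0 < n" and ab: "0 < b" "b < a" "a < real n"
begin

lemma risk_le_1:
  assumes M: "private_extension n K \<beta> w C a b \<epsilon> M"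
  shows "risk n K a b \<sigma> M \<le> 1"
proof -
  have "risk n K a b \<sigma> M \<le> measure_pmf.expectation (SBM n a b \<sigma>) (\<lambda>A. 1)"
    unfolding risk_eq[OF M]
    using set_SBM_subset[of n a b \<sigma>] expectation_loss_le_1[OF M]
    by (intro integral_mono_AE integrable_measure_pmf_finite finite_set_SBM)
      (auto simp: AE_measure_pmf_iff)
  then show ?thesis by simp
qed

text \<open>The labelings of loss at most \<open>x\<close> contribute at most \<open>x\<close> in
  total, because output probabilities sum to 1. Graphs outside the envelope cost their probability,
  as the loss is at most 1. Only the remaining labelings need a union bound.\<close>

lemma risk_le_sum:
  assumes M: "private_extension n K \<beta> w C a b \<epsilon> M" and \<sigma>: "\<sigma> \<in> balanced n K \<beta>"
    and \<theta>: "0 \<le> \<theta>" "\<theta> \<le> 1" "\<theta> * tstar n a b \<le> \<epsilon> / (4 * sens n C a)" and x: "0 \<le> x"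
  shows "risk n K a b \<sigma> M \<le> (1 - measure_pmf.prob (SBM n a b \<sigma>) (envelope n C a)) + x +
    (\<Sum>\<tau> | \<tau> \<in> balanced n K \<beta> \<and> x < loss n K \<sigma> \<tau>.
       loss n K \<sigma> \<tau> * exp (- (\<theta> * (info n a b * weighted_separation n K w \<sigma> \<tau>))))"
proof -
  let ?B = "balanced n K \<beta>" and ?G = "envelope n C a"
  define B' where "B' = {\<tau>. \<tau> \<in> ?B \<and> x < loss n K \<sigma> \<tau>}"
  define gap where "gap A \<tau> = score n (penalty n K w a b) A \<sigma> - score n (penalty n K w a b) A \<tau>" for A \<tau>
  define t where "t = tstar n a b"
  have t: "t > 0" using tstar_pos[OF n ab] by (simp add: t_def)
  have fin: "finite B'" by (simp add: B'_def finite_balanced)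
  have pmf_le: "pmf (M A) \<tau> \<le> exp (- (\<theta> * t) * gap A \<tau>)" if "A \<in> ?G" "\<tau> \<in> ?B" for A \<tau>
  proof (cases "gap A \<tau> \<ge> 0")
    case True
    have "pmf (M A) \<tau> \<le> exp (- (\<epsilon> / (4 * sens n C a)) * gap A \<tau>)"
      using pmf_private_extension_le[OF M that(1) \<sigma> that(2)] by (simp add: gap_def)
    also have "\<dots> \<le> exp (- (\<theta> * t) * gap A \<tau>)"
      using mult_right_mono[OF \<theta>(3) True] by (simp add: t_def)
    finally show ?thesis .
  next
    case False
    then have "0 \<le> - (\<theta> * t) * gap A \<tau>" using \<theta> t by (simp add: mult_nonneg_nonpos)
    then have "1 \<le> exp (- (\<theta> * t) * gap A \<tau>)" by (simp only: one_le_exp_iff)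
    then show ?thesis using pmf_le_1[of "M A" \<tau>] by linarith
  qed
  have main: "measure_pmf.expectation (M A) (loss n K \<sigma>)
      \<le> indicator (- ?G) A + x + (\<Sum>\<tau>\<in>B'. loss n K \<sigma> \<tau> * exp (- (\<theta> * t) * gap A \<tau>))"
    if A: "A \<in> graphs n" for A
  proof (cases "A \<in> ?G")
    case False
    have "0 \<le> (\<Sum>\<tau>\<in>B'. loss n K \<sigma> \<tau> * exp (- (\<theta> * t) * gap A \<tau>))"
      by (intro sum_nonneg mult_nonneg_nonneg loss_nonneg) auto
    then show ?thesis using False expectation_loss_le_1[OF M A, of \<sigma>] x by simp
  next
    case True
    have "(\<Sum>\<tau>\<in>?B. loss n K \<sigma> \<tau> * pmf (M A) \<tau>) \<le>
        (\<Sum>\<tau>\<in>?B. x * pmf (M A) \<tau> + (if x < loss n K \<sigma> \<tau> then loss n K \<sigma> \<tau> * exp (- (\<theta> * t) * gap A \<tau>) else 0))"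
    proof (rule sum_mono)
      fix \<tau> assume \<tau>: "\<tau> \<in> ?B"
      have "loss n K \<sigma> \<tau> * pmf (M A) \<tau> \<le> loss n K \<sigma> \<tau> * exp (- (\<theta> * t) * gap A \<tau>)"
        by (intro mult_left_mono pmf_le True \<tau> loss_nonneg)
      moreover have "loss n K \<sigma> \<tau> * pmf (M A) \<tau> \<le> x * pmf (M A) \<tau>" if "\<not> x < loss n K \<sigma> \<tau>"
        using that by (intro mult_right_mono) auto
      moreover have "0 \<le> x * pmf (M A) \<tau>" using x by simp
      ultimately show "loss n K \<sigma> \<tau> * pmf (M A) \<tau> \<le> x * pmf (M A) \<tau> +
          (if x < loss n K \<sigma> \<tau> then loss n K \<sigma> \<tau> * exp (- (\<theta> * t) * gap A \<tau>) else 0)"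
        by (auto split: if_splits)
    qed
    also have "\<dots> = x + (\<Sum>\<tau>\<in>B'. loss n K \<sigma> \<tau> * exp (- (\<theta> * t) * gap A \<tau>))"
      unfolding sum.distrib sum_distrib_left[symmetric] sum_pmf_balanced[OF M A] B'_def
      by (simp only: sum.inter_filter[OF finite_balanced] mult_1_right)
    finally show ?thesis using True by (simp add: expectation_loss_eq[OF M A])
  qed
  have int: "integrable (measure_pmf (SBM n a b \<sigma>)) h" for h :: "graph \<Rightarrow> real"
    by (rule integrable_measure_pmf_finite[OF finite_set_SBM])
  have "risk n K a b \<sigma> M \<le> measure_pmf.expectation (SBM n a b \<sigma>)
      (\<lambda>A. indicator (- ?G) A + x + (\<Sum>\<tau>\<in>B'. loss n K \<sigma> \<tau> * exp (- (\<theta> * t) * gap A \<tau>)))"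
    unfolding risk_eq[OF M] using set_SBM_subset[of n a b \<sigma>] main
    by (intro integral_mono_AE int) (auto simp: AE_measure_pmf_iff)
  also have "\<dots> = measure_pmf.prob (SBM n a b \<sigma>) (- ?G) + x + (\<Sum>\<tau>\<in>B'. loss n K \<sigma> \<tau> *
      measure_pmf.expectation (SBM n a b \<sigma>) (\<lambda>A. exp (- (\<theta> * t) * gap A \<tau>)))"
    by (simp add: int Bochner_Integration.integral_add Bochner_Integration.integral_sum)
  also have "\<dots> \<le> measure_pmf.prob (SBM n a b \<sigma>) (- ?G) + x + (\<Sum>\<tau>\<in>B'. loss n K \<sigma> \<tau> *
      exp (- \<theta> * (info n a b * weighted_separation n K w \<sigma> \<tau>)))"
    unfolding gap_def t_def
    by (intro add_left_mono sum_mono mult_left_mono expectation_exp_gap_le n ab \<theta> loss_nonneg)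
  also have "measure_pmf.prob (SBM n a b \<sigma>) (- ?G) = 1 - measure_pmf.prob (SBM n a b \<sigma>) ?G"
    using measure_pmf.prob_compl[of ?G "SBM n a b \<sigma>"] by (simp add: Compl_eq_Diff_UNIV)
  finally show ?thesis by (simp add: B'_def)
qed

text \<open>The first bound has the sharp constant but is useful only while the loss is small; the
  second holds at every loss, with a worse constant.\<close>

lemma weighted_separation_ge:
  assumes \<sigma>: "\<sigma> \<in> balanced n K \<beta>" and \<tau>: "\<tau> \<in> balanced n K \<beta>" and \<beta>: "1 \<le> \<beta>" and K: "2 \<le> K"
    and w: "0 \<le> w" "w \<le> 1" and I: "0 \<le> info n a b"
  defines "h \<equiv> real n * loss n K \<sigma> \<tau>" and "S \<equiv> Signal n K \<beta> a b"
  shows "h * (S * (1 - \<beta> * real K * (h / n))) \<le> info n a b * weighted_separation n K w \<sigma> \<tau>"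
    and "h * (S / (\<beta>\<^sup>2 * real K ^ 4)) \<le> info n a b * weighted_separation n K w \<sigma> \<tau>"
proof -
  define w' where "w' = edge_weight K w"
  have w': "0 \<le> w'" "w' \<le> 1" using w by (auto simp: w'_def edge_weight_def)
  define p q where "p = real (separated n \<sigma> \<tau>)" and "q = real (separated n \<tau> \<sigma>)"
  have W: "weighted_separation n K w \<sigma> \<tau> = (1 - w') * p + w' * q"
    by (simp add: weighted_separation_def w'_def p_def q_def)
  \<comment> \<open>Under an arbitrary weight, a lower bound common to both counts carries over to
    the weighted count.\<close>
  have conv: "y \<le> (1 - w') * p + w' * q" if "y \<le> p" "y \<le> q" for y
  proof -
    have "(1 - w') * y + w' * y \<le> (1 - w') * p + w' * q"
      using w' that by (intro add_mono mult_left_mono) auto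
    then show ?thesis by (simp add: algebra_simps)
  qed
  have h: "0 \<le> h" by (simp add: h_def loss_nonneg)
  have \<beta>K: "0 < \<beta> * real K" "2 \<le> \<beta> * real K" using \<beta> K mult_mono[of 1 \<beta> 2 "real K"] by auto
  show "h * (S * (1 - \<beta> * real K * (h / n))) \<le> info n a b * weighted_separation n K w \<sigma> \<tau>"
  proof (cases "K = 2")
    case False
    have "h * (real n / (\<beta> * real K) - h) \<le> (1 - w') * p + w' * q"
      using loss_le_separated_near(1,2)[OF \<sigma> \<tau> n] by (intro conv) (auto simp: h_def p_def q_def)
    then have "info n a b * (h * (real n / (\<beta> * real K) - h)) \<le> info n a b * ((1 - w') * p + w' * q)"
      using I by (rule mult_left_mono)
    moreover have "h * (S * (1 - \<beta> * real K * (h / n))) = info n a b * (h * (real n / (\<beta> * real K) - h))"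
    proof -
      have "h * (real n * info n a b / X * (1 - X * (h / n))) = info n a b * (h * (real n / X - h))"
        if "0 < X" for X using that n by (simp add: field_simps)
      from this[OF \<beta>K(1)] show ?thesis using False by (simp add: S_def Signal_def)
    qed
    ultimately show ?thesis by (simp only: W)
  next
    case True
    \<comment> \<open>Enlarging the subtracted \<open>h\<close> to
      \<open>\<beta> * real K * h\<close> gives K = 2 the same form as the other case.\<close>
    have "h * (real n - \<beta> * real K * h) \<le> h * (real n - h)"
      using h \<beta>K mult_right_mono[of 1 "\<beta> * real K" h] by (intro mult_left_mono) auto
    also have "\<dots> \<le> p + q"
      using loss_le_separated_near(3)[OF \<sigma> \<tau> n True] by (simp add: h_def p_def q_def)
    finally have "info n a b / 2 * (h * (real n - \<beta> * real K * h)) \<le> info n a b / 2 * (p + q)"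
      using I by (intro mult_left_mono) auto
    moreover have "h * (S * (1 - \<beta> * real K * (h / n))) = info n a b / 2 * (h * (real n - \<beta> * real K * h))"
      using True n by (simp add: S_def Signal_def field_simps)
    moreover have "info n a b / 2 * (p + q) = info n a b * ((1 - w') * p + w' * q)"
      using True by (simp add: w'_def edge_weight_def field_simps)
    ultimately show ?thesis by (simp only: W)
  qed
  have "real n * h / (\<beta>\<^sup>2 * real K ^ 4) \<le> (1 - w') * p + w' * q"
    using loss_le_separated[OF \<sigma> \<tau> \<beta> _ n] K \<beta>
    by (intro conv) (auto simp: h_def p_def q_def divide_le_eq mult.commute)
  then have "info n a b * (real n * h / (\<beta>\<^sup>2 * real K ^ 4)) \<le> info n a b * ((1 - w') * p + w' * q)"
    using I by (rule mult_left_mono)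
  moreover have "S \<le> real n * info n a b"
  proof (cases "K = 2")
    case True
    then show ?thesis using I by (simp add: S_def Signal_def)
  next
    case False
    have "real n * info n a b / (\<beta> * real K) \<le> real n * info n a b / 1"
      using I \<beta>K by (intro divide_left_mono) auto
    then show ?thesis using False by (simp add: S_def Signal_def)
  qed
  then have "h * (S / (\<beta>\<^sup>2 * real K ^ 4)) \<le> h * (real n * info n a b / (\<beta>\<^sup>2 * real K ^ 4))"
    using h by (intro mult_left_mono divide_right_mono) auto
  ultimately show "h * (S / (\<beta>\<^sup>2 * real K ^ 4)) \<le> info n a b * weighted_separation n K w \<sigma> \<tau>"
    by (simp add: W mult_ac)
qed

text \<open>The free \<gamma> divides the labelings into near and far ones. The discarded labelings
  and the near ones both cost a multiple of the same \<open>x\<close>, the far ones are counted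
  crudely by K^n.\<close>

lemma risk_le:
  assumes M: "private_extension n K \<beta> w C a b \<epsilon> M" and \<sigma>: "\<sigma> \<in> balanced n K \<beta>"
    and \<beta>: "1 \<le> \<beta>" and K: "2 \<le> K" and w: "0 \<le> w" "w \<le> 1" and I: "0 \<le> info n a b"
    and \<theta>: "0 \<le> \<theta>" "\<theta> \<le> 1" "\<theta> * tstar n a b \<le> \<epsilon> / (4 * sens n C a)"
    and \<gamma>: "0 \<le> \<gamma>"
  defines "S \<equiv> Signal n K \<beta> a b"
  shows "risk n K a b \<sigma> M \<le> (1 - measure_pmf.prob (SBM n a b \<sigma>) (envelope n C a))
    + (1 + fact K) * (exp 1 * (real K * exp (- (\<theta> * S * (1 - \<beta> * real K * \<gamma>)))))
    + real K ^ n * exp (- (real n * \<gamma> * (\<theta> * S / (\<beta>\<^sup>2 * real K ^ 4))))"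
proof -
  define x where "x = exp 1 * (real K * exp (- (\<theta> * S * (1 - \<beta> * real K * \<gamma>))))"
  define J where "J \<tau> = \<theta> * (info n a b * weighted_separation n K w \<sigma> \<tau>)" for \<tau>
  have S: "0 \<le> S" using I \<beta> by (auto simp: S_def Signal_def)
  have "(\<Sum>\<tau> | \<tau> \<in> balanced n K \<beta> \<and> x < loss n K \<sigma> \<tau>. loss n K \<sigma> \<tau> * exp (- J \<tau>))
    \<le> fact K * x + real K ^ n * exp (- (real n * \<gamma> * (\<theta> * S / (\<beta>\<^sup>2 * real K ^ 4))))"
    unfolding x_def
  proof (rule sum_loss_le[OF n, where J = J and \<gamma> = \<gamma> and A = "\<theta> * S * (1 - \<beta> * real K * \<gamma>)"
        and F = "real n * \<gamma> * (\<theta> * S / (\<beta>\<^sup>2 * real K ^ 4))"])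
    fix \<tau> assume \<tau>: "\<tau> \<in> balanced n K \<beta>"
    define h where "h = real n * loss n K \<sigma> \<tau>"
    have h: "0 \<le> h" "h / n = loss n K \<sigma> \<tau>" using n by (simp_all add: h_def loss_nonneg)
    note W = weighted_separation_ge[OF \<sigma> \<tau> \<beta> K w I, folded h_def S_def]
    { assume "loss n K \<sigma> \<tau> \<le> \<gamma>"
      then have "h * (S * (1 - \<beta> * real K * \<gamma>)) \<le> h * (S * (1 - \<beta> * real K * (h / n)))"
        using h S \<beta> by (intro mult_left_mono diff_left_mono) auto
      then have "\<theta> * (h * (S * (1 - \<beta> * real K * \<gamma>))) \<le> J \<tau>"
        unfolding J_def using W(1) \<theta>(1) by (intro mult_left_mono) auto
      then show "real n * loss n K \<sigma> \<tau> * (\<theta> * S * (1 - \<beta> * real K * \<gamma>)) \<le> J \<tau>"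
        by (simp add: h_def mult_ac) }
    { assume "\<gamma> < loss n K \<sigma> \<tau>"
      then have "real n * \<gamma> * (S / (\<beta>\<^sup>2 * real K ^ 4)) \<le> h * (S / (\<beta>\<^sup>2 * real K ^ 4))"
        unfolding h_def using S by (intro mult_right_mono mult_left_mono) auto
      then have "\<theta> * (real n * \<gamma> * (S / (\<beta>\<^sup>2 * real K ^ 4))) \<le> J \<tau>"
        unfolding J_def using W(2) \<theta>(1) by (intro mult_left_mono) auto
      then show "real n * \<gamma> * (\<theta> * S / (\<beta>\<^sup>2 * real K ^ 4)) \<le> J \<tau>" by (simp add: mult_ac) }
  qed
  moreover have "0 \<le> x" by (simp add: x_def)
  note risk_le_sum[OF M \<sigma> \<theta> this]
  ultimately show ?thesis unfolding x_def[symmetric] J_def by (simp add: algebra_simps)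
qed

end

section \<open>The constant-SNR regime\<close>

text \<open>Since q <= p, the Bhattacharyya coefficient is at least 1 - p, and ln(1 - p) >= -2p for
  p <= 1/2.\<close>

lemma info_upper:
  assumes "0 \<le> b" "b < a" "2 * a \<le> real n" "0 < n"
  shows "real n * info n a b \<le> 4 * a"
proof -
  define p q where "p = a / n" and "q = b / n"
  have pq: "0 \<le> q" "q \<le> p" "p \<le> 1 / 2"
    using assms by (simp_all add: p_def q_def divide_simps)
  have "1 - p = sqrt ((1 - p) * (1 - p))" using pq by simp
  also have "\<dots> \<le> sqrt ((1 - p) * (1 - q))"
    using pq by (intro real_sqrt_le_mono mult_left_mono) auto
  also have "\<dots> \<le> sqrt (p * q) + sqrt ((1 - p) * (1 - q))" using pq by simp
  finally have "ln (1 - p) \<le> ln (sqrt (p * q) + sqrt ((1 - p) * (1 - q)))"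
    using pq by (subst ln_le_cancel_iff) auto
  moreover have "- 2 * p \<le> ln (1 - p)"
  proof -
    have "p * p \<le> 1 / 2 * p" using pq by (intro mult_right_mono) auto
    then show ?thesis using ln_one_minus_pos_lower_bound[of p] pq by (simp add: power2_eq_square)
  qed
  ultimately have "info n a b \<le> 4 * p" unfolding info_def p_def q_def by simp
  then show ?thesis using assms by (simp add: p_def field_simps)
qed

text \<open>By ln H <= H - 1, I is at least 2(1 - H), a sum of two squared differences of square
  roots (a Hellinger distance); the edge part alone is at least p(1 - sqrt \<rho>)^2.\<close>

lemma info_lower:
  assumes "0 \<le> b" "b \<le> \<rho> * a" "0 \<le> \<rho>" "\<rho> < 1" "0 < a" "a < real n"
  shows "a * (1 - sqrt \<rho>)\<^sup>2 \<le> real n * info n a b"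
proof -
  have n: "0 < n" using assms by (cases n) auto
  define p q where "p = a / n" and "q = b / n"
  have "b < a" using assms mult_right_mono[of \<rho> 1 a] mult_strict_right_mono[of \<rho> 1 a] by linarith
  then have pq: "0 \<le> q" "q \<le> p" "0 < p" "p < 1"
    using assms n by (simp_all add: p_def q_def divide_simps)
  define H where "H = sqrt (p * q) + sqrt ((1 - p) * (1 - q))"
  have "0 < sqrt ((1 - p) * (1 - q))" using pq by simp
  then have H: "0 < H" using pq by (simp add: H_def add_nonneg_pos)
  have "sqrt q \<le> sqrt p * sqrt \<rho>"
  proof -
    have "q \<le> p * \<rho>" using assms n by (simp add: p_def q_def divide_simps mult.commute)
    then show ?thesis by (simp flip: real_sqrt_mult)
  qed
  then have "sqrt p * (1 - sqrt \<rho>) \<le> sqrt p - sqrt q" by (simp add: algebra_simps)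
  then have "(sqrt p * (1 - sqrt \<rho>))\<^sup>2 \<le> (sqrt p - sqrt q)\<^sup>2"
    using assms pq by (intro power_mono) auto
  then have "p * (1 - sqrt \<rho>)\<^sup>2 \<le> (sqrt p - sqrt q)\<^sup>2"
    using pq by (simp add: power_mult_distrib)
  also have "\<dots> \<le> (sqrt p - sqrt q)\<^sup>2 + (sqrt (1 - p) - sqrt (1 - q))\<^sup>2" by simp
  also have "\<dots> = 2 * (1 - H)"
    using pq by (simp add: power2_diff H_def real_sqrt_mult)
  also have "\<dots> \<le> - 2 * ln H" using ln_le_minus_one[OF H] by simp
  also have "\<dots> = info n a b" by (simp add: info_def H_def p_def q_def)
  finally show ?thesis using n by (simp add: p_def field_simps)
qed

text \<open>What the asymptotic regime yields at one large n, with all constants fixed beforehand.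
  \<open>2 * a \<le> real n\<close> stands for a = o(n), \<open>Kmax \<le> n\<close> gives ln(nK) <=
  2 ln n, and \<open>signal\<close> is the separation assumption with constant 1.\<close>

locale sbm_instance =
  fixes n K Kmax :: nat and a b \<beta> \<rho>\<^sub>1 \<rho>\<^sub>2 C :: real
  assumes n_ge: "2 \<le> n" "Kmax \<le> n"
    and K: "2 \<le> K" "K \<le> Kmax"
    and \<beta>: "1 \<le> \<beta>"
    and \<rho>: "0 < \<rho>\<^sub>1" "\<rho>\<^sub>1 \<le> \<rho>\<^sub>2" "\<rho>\<^sub>2 < 1"
    and C: "0 < C"
    and a: "0 < a" "2 * a \<le> real n"
    and b: "\<rho>\<^sub>1 * a \<le> b" "b \<le> \<rho>\<^sub>2 * a"
    and signal: "ln (real (n * K)) \<le> Signal n K \<beta> a b"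
    and envelope: "\<And>\<sigma>. \<sigma> \<in> balanced n K \<beta> \<Longrightarrow>
      1 - exp (- 10 * (a + ln (real n))) \<le> measure_pmf.prob (SBM n a b \<sigma>) (envelope n C a)"
begin

abbreviation "\<kappa> \<equiv> (1 - sqrt \<rho>\<^sub>2)\<^sup>2"
abbreviation "I \<equiv> info n a b"
abbreviation "S \<equiv> Signal n K \<beta> a b"
abbreviation "\<Delta> \<equiv> sens n C a"
abbreviation "R \<equiv> entropy_ratio n K a b"
abbreviation "t \<equiv> tstar n a b"

section \<open>Orders of magnitude at a fixed n\<close>

lemma n_pos: "0 < n" using n_ge by simp

lemma ln_n_pos: "0 < ln (real n)" using n_ge by simp

lemma b_pos: "0 < b" using a \<rho> b by (meson less_le_trans mult_pos_pos)

lemma b_less: "b < a"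
proof -
  have "\<rho>\<^sub>2 * a < 1 * a" using \<rho> a by (intro mult_strict_right_mono) auto
  then show ?thesis using b by linarith
qed

lemma a_less: "a < real n" using a by simp

lemma kappa: "0 < \<kappa>" "\<kappa> \<le> 1"
  using \<rho> by (auto simp: power_le_one)

lemma ln_n_le: "ln (real n) \<le> ln (real (n * K))"
  using n_ge K by simp

lemma S_ge_ln: "ln (real n) \<le> S"
  using ln_n_le signal by linarith

lemma I_pos: "0 < I"
proof -
  have "0 < a * \<kappa>" using a kappa by simp
  also have "\<dots> \<le> real n * I" using info_lower[of b "\<rho>\<^sub>2" a n] b b_pos \<rho> a a_less by simp
  finally show ?thesis using n_pos by (simp add: zero_less_mult_iff)
qed

lemma ln_nK_pos: "0 < ln (real (n * K))"
  using ln_n_le ln_n_pos by linarith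

lemma nI_pos: "0 < real n * I"
  using n_pos I_pos by simp

lemma S_le: "2 * S \<le> real n * I"
proof (cases "K = 2")
  case False
  have "1 * 2 \<le> \<beta> * real K" using \<beta> K by (intro mult_mono) auto
  then have "real n * I / (\<beta> * real K) \<le> real n * I / 2"
    using nI_pos by (intro divide_left_mono) auto
  moreover have "S = real n * I / (\<beta> * real K)" using False by (simp add: Signal_def)
  ultimately show ?thesis by linarith
qed (simp add: Signal_def)

lemma S_ge: "real n * I / (\<beta> * real Kmax) \<le> S"
proof (cases "K = 2")
  case True
  have "1 * 2 \<le> \<beta> * real Kmax" using \<beta> K by (intro mult_mono) auto
  then have "real n * I / (\<beta> * real Kmax) \<le> real n * I / 2"
    using nI_pos by (intro divide_left_mono) auto
  then show ?thesis using True by (simp add: Signal_def)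
next
  case False
  have "\<beta> * real K \<le> \<beta> * real Kmax" "0 < \<beta> * real K" "0 < \<beta> * real Kmax"
    using \<beta> K by (auto intro: mult_left_mono)
  then have "real n * I / (\<beta> * real Kmax) \<le> real n * I / (\<beta> * real K)"
    using nI_pos \<beta> K by (intro divide_left_mono mult_pos_pos) auto
  then show ?thesis using False by (simp add: Signal_def)
qed

lemma sens_pos: "0 < \<Delta>" using C a by (simp add: sens_def less_max_iff_disj)

text \<open>Of the two entries of the maximum in \<Delta>, the degree scale a is controlled by
  \<open>info_lower\<close> and ln n by the chain ln n <= S <= nI/2.\<close>

lemma sens_le: "\<kappa> * \<Delta> \<le> 2 * C * (real n * I)"
proof -
  have "\<kappa> * a \<le> real n * I"
    using info_lower[of b "\<rho>\<^sub>2" a n] b b_pos \<rho> a a_less by (simp add: mult.commute)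
  moreover have "\<kappa> * ln (real n) \<le> 1 * ln (real n)"
    using kappa ln_n_pos by (intro mult_right_mono) auto
  moreover have "ln (real n) \<le> real n * I" using S_le S_ge_ln ln_n_pos by linarith
  ultimately have "\<kappa> * max a (ln (real n)) \<le> real n * I" by (auto simp: max_def)
  then have "2 * C * (\<kappa> * max a (ln (real n))) \<le> 2 * C * (real n * I)"
    using C by (intro mult_left_mono) auto
  then show ?thesis by (simp add: sens_def mult_ac)
qed

lemma R_nonneg: "0 \<le> R"
  unfolding entropy_ratio_def using nI_pos ln_nK_pos by (intro divide_nonneg_pos mult_nonneg_nonneg) auto

text \<open>With \<Delta> >= 2Ca, nI <= 4a and K >= 2, the product is at least 2Ca * 2 ln n /
  (4a).\<close>

lemma sens_R_lower: "C * ln (real n) \<le> \<Delta> * R"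
proof -
  have "2 * ln (real n) \<le> real K * ln (real (n * K))"
    using K ln_n_le ln_n_pos by (intro mult_mono) auto
  moreover have "real n * I \<le> 4 * a" using info_upper b_pos b_less a n_pos by simp
  ultimately have R: "2 * ln (real n) / (4 * a) \<le> R"
    unfolding entropy_ratio_def using nI_pos ln_nK_pos by (intro frac_le mult_nonneg_nonneg) auto
  have "C * ln (real n) = (2 * C * a) * (2 * ln (real n) / (4 * a))" using a by simp
  also have "\<dots> \<le> \<Delta> * (2 * ln (real n) / (4 * a))"
    using C a ln_n_pos by (intro mult_right_mono) (auto simp: sens_def)
  also have "\<dots> \<le> \<Delta> * R" using sens_pos R by (intro mult_left_mono) auto
  finally show ?thesis .
qed

text \<open>\<Delta> is at most 2C/\<kappa> times nI, which cancels the denominator of R. Using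
  \<open>Kmax + 1\<close> instead of \<open>Kmax\<close> keeps the constant positive for every value
  of \<open>Kmax\<close>, so that it can serve as a divisor before anything is known about
  K.\<close>

lemma sens_R_upper: "\<Delta> * R \<le> 4 * C * real (Kmax + 1) / \<kappa> * ln (real n)"
proof -
  have "\<kappa> * (\<Delta> * R) = (\<kappa> * \<Delta>) * (real K * ln (real (n * K))) / (real n * I)"
    by (simp add: entropy_ratio_def)
  also have "\<dots> \<le> (2 * C * (real n * I)) * (real K * ln (real (n * K))) / (real n * I)"
    using sens_le I_pos nI_pos ln_nK_pos by (intro divide_right_mono mult_right_mono mult_nonneg_nonneg) auto
  also have "\<dots> = 2 * C * (real K * ln (real (n * K)))"
    using n_pos I_pos by simp
  also have "\<dots> \<le> 2 * C * (real (Kmax + 1) * (2 * ln (real n)))"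
  proof (intro mult_left_mono mult_mono)
    have "real (n * K) \<le> real n * real n" using n_ge K by simp
    then have "ln (real (n * K)) \<le> ln (real n * real n)"
      using n_pos K by (subst ln_le_cancel_iff) auto
    then show "ln (real (n * K)) \<le> 2 * ln (real n)" using n_pos by (simp add: ln_mult)
  qed (use C K ln_nK_pos in auto)
  finally show ?thesis using kappa(1) by (simp add: field_simps)
qed

lemma t_pos: "0 < t" using tstar_pos[OF n_pos b_pos b_less a_less] .

text \<open>Bounds t* independently of n, so that t* s* is of the order of s*. The 2 comes from 1 -
  a/n >= 1/2.\<close>

lemma t_le: "t \<le> ln (2 / \<rho>\<^sub>1)"
proof -
  have le1: "a / b \<le> 1 / \<rho>\<^sub>1" using b_pos b \<rho> by (simp add: field_simps)
  have p: "0 < 1 - a / n" "1 - b / n \<le> 1" "1 / 2 \<le> 1 - a / n" "0 < 1 - b / n"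
    using a b_pos n_pos a_less b_less by (simp_all add: field_simps)
  have le2: "(1 - b / n) / (1 - a / n) \<le> 1 / (1 / 2)"
    using p by (intro frac_le) auto
  have eq: "a * (1 - b / n) / (b * (1 - a / n)) = (a / b) * ((1 - b / n) / (1 - a / n))" by simp
  have "a * (1 - b / n) / (b * (1 - a / n)) \<le> (1 / \<rho>\<^sub>1) * (1 / (1 / 2))"
    unfolding eq using le1 le2 p a b_pos \<rho> by (intro mult_mono) auto
  moreover have "0 < a * (1 - b / n) / (b * (1 - a / n))" using p a b_pos by simp
  ultimately have "ln (a * (1 - b / n) / (b * (1 - a / n))) \<le> ln (2 / \<rho>\<^sub>1)"
    using \<rho> by (subst ln_le_cancel_iff) auto
  then have "2 * t \<le> ln (2 / \<rho>\<^sub>1)" by (simp add: tstar_def)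
  then show ?thesis using t_pos by linarith
qed

text \<open>Since \<open>t\<close> is bounded and \<Delta> is at most a constant times S, \<eta> S /
  t is at least a constant times \<epsilon>: even a small \<theta> leaves an exponent growing like
  ln n. The constant collects \<kappa>/(2C) from \<open>sens_le\<close>,
  \<open>\<beta> * real Kmax\<close> from \<open>S_ge\<close>, the 4 in \<eta> and the bound on
  \<open>t\<close>.\<close>

lemma theta_S_ge:
  fixes \<epsilon> L :: real
  assumes L: "0 \<le> L" "L * ln (real n) \<le> \<epsilon>"
  shows "min 1 (L * \<kappa> / (8 * C * \<beta> * real Kmax * ln (2 / \<rho>\<^sub>1))) * ln (real n)
    \<le> min 1 (\<epsilon> / (4 * \<Delta>) / t) * S"
proof -
  have \<beta>K: "0 < \<beta> * real Kmax" using \<beta> K by simp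
  have T: "0 < ln (2 / \<rho>\<^sub>1)" using t_le t_pos by linarith
  have "L * \<kappa> / (8 * C * \<beta> * real Kmax * ln (2 / \<rho>\<^sub>1)) * ln (real n) \<le> \<epsilon> / (4 * \<Delta>) / t * S"
  proof -
    have "L * ln (real n) * (\<kappa> / (8 * C * (\<beta> * real Kmax))) \<le> \<epsilon> * (S / (4 * \<Delta>))"
    proof (intro mult_mono L(2))
      have "\<kappa> / (8 * C * (\<beta> * real Kmax)) = (\<kappa> * \<Delta>) / (\<beta> * real Kmax) / (8 * C * \<Delta>)"
        using sens_pos by simp
      also have "\<dots> \<le> (2 * C * (real n * I)) / (\<beta> * real Kmax) / (8 * C * \<Delta>)"
        using sens_le \<beta>K sens_pos C by (intro divide_right_mono) auto
      also have "\<dots> = real n * I / (\<beta> * real Kmax) / (4 * \<Delta>)" using C by simp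
      also have "\<dots> \<le> S / (4 * \<Delta>)" using S_ge sens_pos by (intro divide_right_mono) auto
      finally show "\<kappa> / (8 * C * (\<beta> * real Kmax)) \<le> S / (4 * \<Delta>)" .
      show "0 \<le> \<epsilon>" using L mult_nonneg_nonneg[of L "ln (real n)"] ln_n_pos by linarith
      show "0 \<le> \<kappa> / (8 * C * (\<beta> * real Kmax))" using kappa C \<beta>K by simp
    qed
    moreover have "0 \<le> L * ln (real n) * (\<kappa> / (8 * C * (\<beta> * real Kmax)))"
      using L ln_n_pos kappa C \<beta>K by simp
    ultimately have "L * ln (real n) * (\<kappa> / (8 * C * (\<beta> * real Kmax))) / ln (2 / \<rho>\<^sub>1)
        \<le> \<epsilon> * (S / (4 * \<Delta>)) / t"
      using t_le t_pos by (intro frac_le) auto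
    then show ?thesis by (simp add: mult_ac)
  qed
  moreover have "min 1 x * ln (real n) \<le> min 1 y * S" if "x * ln (real n) \<le> y * S" for x y
  proof -
    have "min 1 x * ln (real n) \<le> 1 * ln (real n)" "min 1 x * ln (real n) \<le> x * ln (real n)"
      using ln_n_pos by (auto intro: mult_right_mono)
    then show ?thesis using that S_ge_ln by (cases "1 \<le> y") auto
  qed
  ultimately show ?thesis by blast
qed

text \<open>Beyond the fraction \<open>1 / sqrt (ln n)\<close> of misclassified vertices only a constant part of the
  exponent survives, but there it is multiplied by \<open>n / sqrt (ln n)\<close>.\<close>

lemma risk_le_exp_theta:
  fixes \<epsilon> L c :: real
  assumes M: "private_extension n K \<beta> w C a b \<epsilon> M" and \<sigma>: "\<sigma> \<in> balanced n K \<beta>"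
    and w: "0 \<le> w" "w \<le> 1"
    and \<epsilon>: "0 \<le> \<epsilon>"
    and c: "c * ln (real n) \<le> min 1 (\<epsilon> / (4 * \<Delta>) / t) * S"
    and large: "2 * ln (real Kmax) \<le> c * sqrt (ln (real n)) / (\<beta>\<^sup>2 * real Kmax ^ 4)"
      "2 * (\<beta>\<^sup>2 * real Kmax ^ 4) * sqrt (ln (real n)) \<le> real n"
  defines "\<theta> \<equiv> min 1 (\<epsilon> / (4 * \<Delta>) / t)" and "g \<equiv> \<beta> * real Kmax / sqrt (ln (real n))"
  shows "risk n K a b \<sigma> M \<le> exp (- 10 * (a + ln (real n)))
    + ((1 + fact Kmax) * (exp 1 * real Kmax) + 1) * exp (- (\<theta> * S * (1 - g)))"
proof -
  define q where "q = sqrt (ln (real n))"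
  have q: "0 < q" "q * q = ln (real n)" using ln_n_pos by (simp_all add: q_def)
  \<comment> \<open>Small enough for \<open>g\<close> to tend to 0, yet \<gamma> c ln n = c sqrt(ln
    n) still diverges and eventually beats ln K.\<close>
  define \<gamma> where "\<gamma> = 1 / q"
  have \<gamma>: "0 \<le> \<gamma>" using q by (simp add: \<gamma>_def)
  have \<theta>: "0 \<le> \<theta>" "\<theta> \<le> 1" using \<epsilon> sens_pos t_pos by (auto simp: \<theta>_def)
  have \<theta>t: "\<theta> * t \<le> \<epsilon> / (4 * \<Delta>)"
  proof -
    have "\<theta> * t \<le> \<epsilon> / (4 * \<Delta>) / t * t" using t_pos unfolding \<theta>_def by (intro mult_right_mono) auto
    then show ?thesis using t_pos by simp
  qed
  have S0: "0 \<le> S" using S_ge_ln ln_n_pos by linarith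
  have \<theta>S: "0 \<le> \<theta> * S" using S0 \<theta> by simp
  have cn: "c * ln (real n) \<le> \<theta> * S" using c by (simp add: \<theta>_def)
  define D where "D = \<beta>\<^sup>2 * real Kmax ^ 4"
  have D: "0 < D" "0 < \<beta>\<^sup>2 * real K ^ 4" "\<beta>\<^sup>2 * real K ^ 4 \<le> D"
    unfolding D_def using \<beta> K by (auto intro!: mult_left_mono power_mono)
  \<comment> \<open>The far exponent is nY. By \<open>Y1\<close> one half of it absorbs K^n, and by
    \<open>Y2\<close> the other half leaves at most exp(-\<theta>S).\<close>
  define Y where "Y = \<gamma> * (\<theta> * S / (\<beta>\<^sup>2 * real K ^ 4))"
  have Y_ge: "\<gamma> * (\<theta> * S) / D \<le> Y"
  proof -
    have "\<theta> * S / D \<le> \<theta> * S / (\<beta>\<^sup>2 * real K ^ 4)" using \<theta>S D by (intro divide_left_mono) auto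
    then show ?thesis unfolding Y_def using \<gamma> mult_left_mono by fastforce
  qed
  have "c * q / D = \<gamma> * (c * (q * q)) / D" using q(1) by (simp add: \<gamma>_def)
  also have "\<dots> \<le> \<gamma> * (\<theta> * S) / D" unfolding q(2)
    using cn \<gamma> D by (intro divide_right_mono mult_left_mono) auto
  finally have "2 * ln (real Kmax) \<le> Y" using large(1) Y_ge by (simp add: q_def D_def)
  then have Y1: "2 * ln (real K) \<le> Y" 
  proof -
    have "ln (real K) \<le> ln (real Kmax)" using K by simp
    then show ?thesis using \<open>2 * ln (real Kmax) \<le> Y\<close> by linarith
  qed
  have Y2: "2 * (\<theta> * S) \<le> real n * Y"
  proof -
    have "2 * (\<theta> * S) = 2 * D * q * (\<gamma> * (\<theta> * S) / D)" using q D by (simp add: \<gamma>_def)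
    also have "\<dots> \<le> real n * Y"
      using large(2) Y_ge \<theta>S \<gamma> D by (intro mult_mono) (auto simp: q_def D_def)
    finally show ?thesis .
  qed
  have far: "real K ^ n * exp (- (real n * \<gamma> * (\<theta> * S / (\<beta>\<^sup>2 * real K ^ 4)))) \<le> exp (- (\<theta> * S * (1 - g)))"
  proof -
    have "real K ^ n = exp (real n * ln (real K))"
      using K by (simp add: exp_of_nat_mult)
    then have "real K ^ n * exp (- (real n * \<gamma> * (\<theta> * S / (\<beta>\<^sup>2 * real K ^ 4))))
        = exp (real n * ln (real K) - real n * Y)"
      by (simp add: Y_def mult.assoc exp_diff exp_minus divide_inverse)
    moreover have "2 * (real n * ln (real K)) \<le> real n * Y"
      using mult_left_mono[OF Y1, of "real n"] by (simp add: mult_ac)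
    moreover have "\<theta> * S * (1 - g) \<le> \<theta> * S"
      using \<theta>S \<beta> q by (simp add: g_def q_def right_diff_distrib)
    ultimately show ?thesis using Y2 by simp
  qed
  have near: "(1 + fact K) * (exp 1 * (real K * exp (- (\<theta> * S * (1 - \<beta> * real K * \<gamma>)))))
    \<le> (1 + fact Kmax) * (exp 1 * (real Kmax * exp (- (\<theta> * S * (1 - g)))))"
  proof -
    have "\<beta> * real K * \<gamma> \<le> g"
      using K \<beta> q by (simp add: g_def \<gamma>_def q_def divide_right_mono mult_left_mono)
    then have "\<theta> * S * (1 - g) \<le> \<theta> * S * (1 - \<beta> * real K * \<gamma>)"
      using \<theta>S by (intro mult_left_mono) auto
    moreover have "(fact K :: real) \<le> fact Kmax" using K by (intro fact_mono) auto
    ultimately show ?thesis using K by (intro mult_mono add_left_mono) auto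
  qed
  have "1 - measure_pmf.prob (SBM n a b \<sigma>) (envelope n C a) \<le> exp (- 10 * (a + ln (real n)))"
    using envelope[OF \<sigma>] by linarith
  moreover note risk_le[OF n_pos b_pos b_less a_less M \<sigma> \<beta> K(1) w less_imp_le[OF I_pos] \<theta> \<theta>t \<gamma>] near far
  ultimately have "risk n K a b \<sigma> M \<le> exp (- 10 * (a + ln (real n)))
    + (1 + fact Kmax) * (exp 1 * (real Kmax * exp (- (\<theta> * S * (1 - g))))) + exp (- (\<theta> * S * (1 - g)))"
    by linarith
  then show ?thesis by (simp add: algebra_simps)
qed

lemma risk_le_tradeoff:
  fixes \<epsilon> \<alpha> g Q :: real
  assumes M: "private_extension n K \<beta> w C a b \<epsilon> M"
    and risk: "risk n K a b \<sigma> M \<le> E + Q * exp (- (min 1 (\<epsilon> / (4 * \<Delta>) / t) * S * (1 - g)))"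
    and E: "0 \<le> E" and Q: "1 \<le> Q" "Q \<le> real n"
    and \<gamma>: "R < \<epsilon> / (4 * \<Delta>)" and \<alpha>: "0 < \<alpha>" "\<alpha> < 1 / 2"
  defines "\<delta> \<equiv> - (g + ln Q / ln (real n))"
    and "s \<equiv> (ln (real (n * K)) + ln (4 / \<alpha>)) / (\<epsilon> / (4 * \<Delta>) - R)"
  shows "risk n K a b \<sigma> M \<le> exp (- (1 + \<delta>) * S + t * s) + \<alpha> + E"
proof -
  define \<eta> where "\<eta> = \<epsilon> / (4 * \<Delta>)"
  have \<eta>: "0 < \<eta>" "R < \<eta>" using \<gamma> R_nonneg by (simp_all add: \<eta>_def)
  have ln\<alpha>: "0 < ln (4 / \<alpha>)" using \<alpha> by simp
  have num: "0 < ln (real (n * K)) + ln (4 / \<alpha>)" using ln\<alpha> ln_nK_pos by linarith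
  have s: "0 < s" using num \<eta> unfolding s_def \<eta>_def[symmetric] by (intro divide_pos_pos) auto
  have S: "0 < S" using S_ge_ln ln_n_pos by linarith
  \<comment> \<open>Because S >= ln n, the constant ln Q is at most S times ln Q / ln n; this is the
    second part of \<delta>.\<close>
  have "ln Q * 1 \<le> ln Q * (S / ln (real n))"
    using Q S_ge_ln ln_n_pos by (intro mult_left_mono) auto
  then have \<delta>S: "(1 + \<delta>) * S \<le> S * (1 - g) - ln Q" by (simp add: \<delta>_def algebra_simps)
  show ?thesis
  proof (cases "t \<le> \<eta>")
    case True
    then have "min 1 (\<eta> / t) = 1" using t_pos by simp
    then have "risk n K a b \<sigma> M \<le> E + Q * exp (- (S * (1 - g)))" using risk by (simp add: \<eta>_def)
    also have "Q * exp (- (S * (1 - g))) = exp (ln Q) * exp (- (S * (1 - g)))" using Q by simp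
    also have "\<dots> = exp (- (S * (1 - g) - ln Q))" by (simp flip: exp_add)
    also have "\<dots> \<le> exp (- (1 + \<delta>) * S + t * s)"
    proof -
      have "- (S * (1 - g) - ln Q) \<le> - ((1 + \<delta>) * S) + t * s"
        using \<delta>S mult_pos_pos[OF t_pos s] by linarith
      then show ?thesis by (simp only: exp_le_cancel_iff mult_minus_left)
    qed
    finally show ?thesis using \<alpha> by linarith
  next
    case False
    then have \<theta>: "min 1 (\<eta> / t) = \<eta> / t" using t_pos by simp
    show ?thesis
    proof (cases "(1 + \<delta>) * S \<le> t * s")
      case True
      then have "1 \<le> exp (- (1 + \<delta>) * S + t * s)" by (simp only: one_le_exp_iff mult_minus_left)
      then show ?thesis using risk_le_1[OF n_pos b_pos b_less a_less M, of \<sigma>] \<alpha> E by linarith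
    next
      case False
      \<comment> \<open>Here t s <= S(1 - g), so the exponent (\<eta>/t) S (1 - g) is at least
        \<eta> s, hence at least (\<eta> - R) s, which is ln(nK) + ln(4/\<alpha>). Of this, ln(nK)
        pays for Q <= n and ln(4/\<alpha>) brings the rest below \<alpha>.\<close>
      have "ln (real (n * K)) + ln (4 / \<alpha>) = (\<eta> - R) * s"
        using \<eta> by (simp add: s_def \<eta>_def)
      also have "\<dots> \<le> \<eta> * s" using s R_nonneg by (intro mult_right_mono) auto
      also have "\<dots> = \<eta> / t * (t * s)" using t_pos by simp
      also have "\<dots> \<le> \<eta> / t * (S * (1 - g))"
      proof (rule mult_left_mono)
        show "t * s \<le> S * (1 - g)" using False \<delta>S ln_ge_zero[OF Q(1)] by linarith
        show "0 \<le> \<eta> / t" using \<eta> t_pos by simp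
      qed
      finally have *: "ln (real n) + ln (4 / \<alpha>) \<le> \<eta> / t * S * (1 - g)"
        using ln_n_le by (simp add: mult.assoc)
      have "ln Q \<le> ln (real n)" using Q n_pos by simp
      moreover have "ln (4 / \<alpha>) = ln 4 - ln \<alpha>" using \<alpha> by (simp add: ln_div)
      moreover have "0 < ln (4 :: real)" by simp
      ultimately have "ln Q - \<eta> / t * S * (1 - g) \<le> ln \<alpha>" using * by linarith
      then have "exp (ln Q - \<eta> / t * S * (1 - g)) \<le> exp (ln \<alpha>)" by (simp only: exp_le_cancel_iff)
      then have "Q * exp (- (\<eta> / t * S * (1 - g))) \<le> \<alpha>"
        using Q \<alpha> by (simp add: exp_diff exp_minus field_simps)
      then have "risk n K a b \<sigma> M \<le> E + \<alpha>" using risk by (simp only: \<theta> \<eta>_def[symmetric])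
      then show ?thesis using exp_ge_zero[of "- (1 + \<delta>) * S + t * s"] by linarith
    qed
  qed
qed

text \<open>With l = ln(nK), the numerator is at most 3l + c_3 \<epsilon>/2 since ln 4 <= l, and
  \<eta> >= 2R makes the denominator at least \<eta>/2 = \<epsilon>/(8\<Delta>). The quotient is 24
  \<Delta> l/\<epsilon> + 4 c_3 \<Delta>.\<close>

lemma privacy_slack_le:
  fixes \<epsilon> c\<^sub>3 :: real
  assumes \<epsilon>: "0 < \<epsilon>" and c\<^sub>3: "0 < c\<^sub>3" and \<eta>: "2 * R \<le> \<epsilon> / (4 * \<Delta>)"
  defines "\<alpha> \<equiv> 1 / real (n * K) * exp (- c\<^sub>3 * \<epsilon> / 2)"
  shows "0 < \<alpha>" "\<alpha> < 1 / 2"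
    and "(ln (real (n * K)) + ln (4 / \<alpha>)) / (\<epsilon> / (4 * \<Delta>) - R)
      \<le> (24 + 4 * c\<^sub>3) * (\<Delta> * (ln (real (n * K)) / \<epsilon>) + \<Delta>)"
proof -
  define l where "l = ln (real (n * K))"
  have "2 * 2 \<le> n * K" using n_ge K by (intro mult_mono) auto
  then have "real (2 * 2) \<le> real (n * K)" by (simp only: of_nat_le_iff)
  then have nK: "4 \<le> real (n * K)" by simp
  show "0 < \<alpha>" unfolding \<alpha>_def using nK by (intro mult_pos_pos) auto
  have "\<alpha> \<le> 1 / 4 * 1"
    unfolding \<alpha>_def using nK \<epsilon> c\<^sub>3 by (intro mult_mono frac_le) auto
  then show "\<alpha> < 1 / 2" by simp
  have l: "ln 4 \<le> l" unfolding l_def using nK by (subst ln_le_cancel_iff) auto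
  have l0: "0 < l" using ln_nK_pos by (simp add: l_def)
  have "ln (4 / \<alpha>) = ln 4 + l + c\<^sub>3 * \<epsilon> / 2"
  proof -
    have "4 / \<alpha> = 4 * real (n * K) * exp (c\<^sub>3 * \<epsilon> / 2)"
      unfolding \<alpha>_def using nK by (simp add: exp_minus field_simps)
    then show ?thesis using n_pos K by (simp add: ln_mult l_def)
  qed
  then have num: "l + ln (4 / \<alpha>) \<le> 3 * l + c\<^sub>3 * \<epsilon> / 2" using l by linarith
  have "0 < \<epsilon> / (8 * \<Delta>)" using \<epsilon> sens_pos by simp
  moreover have "\<epsilon> / (8 * \<Delta>) \<le> \<epsilon> / (4 * \<Delta>) - R" using \<eta> by (simp add: field_simps)
  ultimately have "(l + ln (4 / \<alpha>)) / (\<epsilon> / (4 * \<Delta>) - R) \<le> (3 * l + c\<^sub>3 * \<epsilon> / 2) / (\<epsilon> / (8 * \<Delta>))"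
    using num l0 \<epsilon> c\<^sub>3 by (intro frac_le) (auto intro: add_nonneg_nonneg)
  also have "\<dots> = 24 * (\<Delta> * (l / \<epsilon>)) + 4 * c\<^sub>3 * \<Delta>" using \<epsilon> sens_pos by (simp add: field_simps)
  also have "\<dots> \<le> (24 + 4 * c\<^sub>3) * (\<Delta> * (l / \<epsilon>)) + (24 + 4 * c\<^sub>3) * \<Delta>"
    using \<epsilon> c\<^sub>3 sens_pos l0 by (intro add_mono mult_right_mono) auto
  finally show "(ln (real (n * K)) + ln (4 / \<alpha>)) / (\<epsilon> / (4 * \<Delta>) - R)
      \<le> (24 + 4 * c\<^sub>3) * (\<Delta> * (ln (real (n * K)) / \<epsilon>) + \<Delta>)"
    by (simp add: l_def distrib_left)
qed

end

section \<open>From the asymptotic regime to a single large n, and the final assembly\<close>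

lemma eventually_sbm_instance:
  assumes reg: "regime 1 \<beta> \<rho>\<^sub>1 \<rho>\<^sub>2 Kmax C K a b"
    and \<rho>: "0 < \<rho>\<^sub>1" "\<rho>\<^sub>1 \<le> \<rho>\<^sub>2" "\<rho>\<^sub>2 < 1" and C: "0 < C"
  shows "\<forall>\<^sub>F n in sequentially. sbm_instance n (K n) Kmax (a n) (b n) \<beta> \<rho>\<^sub>1 \<rho>\<^sub>2 C"
proof -
  have model: "1 \<le> \<beta>" "\<And>n. 2 \<le> n \<Longrightarrow> 2 \<le> K n \<and> 0 \<le> b n \<and> b n < a n"
    using reg by (auto simp: regime_def model_def)
  have env: "\<And>n \<sigma>. 2 \<le> n \<Longrightarrow> \<sigma> \<in> balanced n (K n) \<beta> \<Longrightarrow>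
      1 - exp (- 10 * (a n + ln (real n))) \<le> measure_pmf.prob (SBM n (a n) (b n) \<sigma>) (envelope n C (a n))"
    using reg unfolding regime_def envelope_whp_def by blast
  have "a \<in> o(\<lambda>n. real n)" using reg by (simp add: regime_def)
  from landau_o.smallD[OF this, of "1 / 2"]
  have small: "\<forall>\<^sub>F n in sequentially. \<bar>a n\<bar> \<le> 1 / 2 * real n" by simp
  have snr: "\<forall>\<^sub>F n in sequentially. \<rho>\<^sub>1 \<le> b n / a n \<and> b n / a n \<le> \<rho>\<^sub>2"
    using reg by (simp add: regime_def constant_SNR_def)
  have sig: "\<forall>\<^sub>F n in sequentially. ln (real (n * K n)) \<le> Signal n (K n) \<beta> (a n) (b n)"
    using reg by (simp add: regime_def signal_entropy_separation_def)
  have Kb: "\<forall>\<^sub>F n in sequentially. K n \<le> Kmax" using reg by (simp add: regime_def)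
  show ?thesis
    using small snr sig Kb eventually_ge_at_top[of "max 2 Kmax"]
  proof eventually_elim
    case (elim n)
    then have n: "2 \<le> n" "Kmax \<le> n" by auto
    have "0 < a n" using model(2)[OF n(1)] by simp
    then show ?case using elim n model env \<rho> C
      by unfold_locales (auto simp: field_simps)
  qed
qed

context sbm_instance
begin

text \<open>Explains L: four times the constant of \<open>sens_R_upper\<close> matches the 4 in
  \<eta>, and the extra 1 makes the inequality strict.\<close>

lemma noise_rate_gt:
  fixes \<epsilon> :: real
  assumes "(16 * C * real (Kmax + 1) / \<kappa> + 1) * ln (real n) \<le> \<epsilon>"
  shows "R < \<epsilon> / (4 * \<Delta>)" and "0 < \<epsilon>"
proof -
  have "4 * (\<Delta> * R) \<le> 4 * (4 * C * real (Kmax + 1) / \<kappa> * ln (real n))"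
    using sens_R_upper by (intro mult_left_mono) auto
  also have "\<dots> < (16 * C * real (Kmax + 1) / \<kappa> + 1) * ln (real n)"
    using ln_n_pos by (simp add: algebra_simps)
  finally have *: "4 * (\<Delta> * R) < \<epsilon>" using assms by linarith
  then show "R < \<epsilon> / (4 * \<Delta>)" using sens_pos by (simp add: field_simps)
  have "0 \<le> \<Delta> * R" using sens_pos R_nonneg by simp
  then show "0 < \<epsilon>" using * by linarith
qed

lemma risk_le_log_budget:
  fixes \<epsilon> \<alpha> L c Q :: real
  assumes M: "private_extension n K \<beta> w C a b \<epsilon> M" and \<sigma>: "\<sigma> \<in> balanced n K \<beta>"
    and w: "0 \<le> w" "w \<le> 1"
    and L: "L = 16 * C * real (Kmax + 1) / \<kappa> + 1" "L * ln (real n) \<le> \<epsilon>"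
    and c: "c = min 1 (L * \<kappa> / (8 * C * \<beta> * real Kmax * ln (2 / \<rho>\<^sub>1)))"
    and Q: "Q = (1 + fact Kmax) * (exp 1 * real Kmax) + 1"
    and large: "2 * ln (real Kmax) \<le> c * sqrt (ln (real n)) / (\<beta>\<^sup>2 * real Kmax ^ 4)"
      "2 * (\<beta>\<^sup>2 * real Kmax ^ 4) * sqrt (ln (real n)) \<le> real n" "Q \<le> real n"
    and \<alpha>: "0 < \<alpha>" "\<alpha> < 1 / 2"
  shows "risk n K a b \<sigma> M \<le>
    exp (- (1 - (\<beta> * real Kmax / sqrt (ln (real n)) + ln Q / ln (real n))) * S
      + t * ((ln (real (n * K)) + ln (4 / \<alpha>)) / (\<epsilon> / (4 * \<Delta>) - R)))
    + \<alpha> + exp (- (a + ln (real n)))"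
proof -
  have \<epsilon>: "R < \<epsilon> / (4 * \<Delta>)" "0 < \<epsilon>" using noise_rate_gt L by simp_all
  have L0: "0 \<le> L" using C kappa by (simp add: L(1))
  have Q1: "1 \<le> Q" by (simp add: Q)
  have "exp (- 10 * (a + ln (real n))) \<le> exp (- (a + ln (real n)))" using a ln_n_pos by simp
  moreover note risk_le_exp_theta[OF M \<sigma> w less_imp_le[OF \<epsilon>(2)]
    theta_S_ge[OF L0 L(2), folded c] large(1,2), folded Q]
  ultimately have "risk n K a b \<sigma> M \<le> exp (- (a + ln (real n))) +
      Q * exp (- (min 1 (\<epsilon> / (4 * \<Delta>) / t) * S * (1 - \<beta> * real Kmax / sqrt (ln (real n)))))"
    by linarith
  from risk_le_tradeoff[OF M this _ Q1 large(3) \<epsilon>(1) \<alpha>] show ?thesis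
    by (simp only: add_uminus_conv_diff exp_ge_zero)
qed

end

lemma feasible_imp_log_budget:
  assumes reg: "regime 1 \<beta> \<rho>\<^sub>1 \<rho>\<^sub>2 Kmax C K a b"
    and \<rho>: "0 < \<rho>\<^sub>1" "\<rho>\<^sub>1 \<le> \<rho>\<^sub>2" "\<rho>\<^sub>2 < 1" and C: "0 < C" and c: "0 < c"
    and \<epsilon>: "\<forall>\<^sub>F n in sequentially. c * (sens n C (a n) * entropy_ratio n (K n) (a n) (b n)) \<le> \<epsilon> n"
  shows "\<forall>\<^sub>F n in sequentially. c * C * ln (real n) \<le> \<epsilon> n"
  using eventually_sbm_instance[OF reg \<rho> C] \<epsilon>
proof eventually_elim
  case (elim n)
  interpret sbm_instance n "K n" Kmax "a n" "b n" \<beta> \<rho>\<^sub>1 \<rho>\<^sub>2 C by (fact elim)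
  have "c * (C * ln (real n)) \<le> c * (sens n C (a n) * entropy_ratio n (K n) (a n) (b n))"
    using sens_R_lower c by (intro mult_left_mono) auto
  then show ?case using elim by (simp add: mult.assoc)
qed

lemma log_budget_imp_feasible:
  assumes reg: "regime 1 \<beta> \<rho>\<^sub>1 \<rho>\<^sub>2 Kmax C K a b"
    and \<rho>: "0 < \<rho>\<^sub>1" "\<rho>\<^sub>1 \<le> \<rho>\<^sub>2" "\<rho>\<^sub>2 < 1" and C: "0 < C" and c: "0 < c"
    and \<epsilon>: "\<forall>\<^sub>F n in sequentially. c * ln (real n) \<le> \<epsilon> n"
  shows "\<forall>\<^sub>F n in sequentially. c / (4 * C * real (Kmax + 1) / (1 - sqrt \<rho>\<^sub>2)\<^sup>2)
    * (sens n C (a n) * entropy_ratio n (K n) (a n) (b n)) \<le> \<epsilon> n"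
  using eventually_sbm_instance[OF reg \<rho> C] \<epsilon>
proof eventually_elim
  case (elim n)
  interpret sbm_instance n "K n" Kmax "a n" "b n" \<beta> \<rho>\<^sub>1 \<rho>\<^sub>2 C by (fact elim)
  define U where "U = 4 * C * real (Kmax + 1) / (1 - sqrt \<rho>\<^sub>2)\<^sup>2"
  have U: "0 < U" using C kappa by (simp add: U_def)
  have "sens n C (a n) * entropy_ratio n (K n) (a n) (b n) \<le> U * ln (real n)"
    using sens_R_upper by (simp only: U_def)
  then have "c / U * (sens n C (a n) * entropy_ratio n (K n) (a n) (b n)) \<le> c / U * (U * ln (real n))"
    using c U by (intro mult_left_mono) auto
  also have "\<dots> = c * ln (real n)" using U by simp
  finally show ?case unfolding U_def using elim(2) by linarith
qed

text \<open>The factors 1 below stand for the constants \<open>C\<^sub>0\<close>, \<open>C\<^sub>1\<close>, \<open>c\<^sub>0\<close>, \<open>c\<^sub>1\<close>.\<close>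

lemma log_budget_sufficient:
  fixes \<beta> \<rho>\<^sub>1 \<rho>\<^sub>2 w C c\<^sub>3 :: real and Kmax :: nat
  assumes reg: "regime 1 \<beta> \<rho>\<^sub>1 \<rho>\<^sub>2 Kmax C K a b"
    and \<rho>: "0 < \<rho>\<^sub>1" "\<rho>\<^sub>1 \<le> \<rho>\<^sub>2" "\<rho>\<^sub>2 < 1" and w: "0 \<le> w" "w \<le> 1" and C: "0 < C"
    and c\<^sub>3: "0 < c\<^sub>3"
  defines "L \<equiv> 16 * C * real (Kmax + 1) / (1 - sqrt \<rho>\<^sub>2)\<^sup>2 + 1"
    and "D \<equiv> (1 + ln (2 / \<rho>\<^sub>1)) * (24 + 4 * c\<^sub>3)"
  assumes \<epsilon>: "\<forall>\<^sub>F n in sequentially. \<epsilon> n \<ge> L * ln (real n)"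
  shows "\<exists>\<delta> :: nat \<Rightarrow> real. \<delta> \<longlonglongrightarrow> 0 \<and>
    (\<forall>\<^sub>F n in sequentially.
       let \<Delta> = sens n C (a n);
           S = Signal n (K n) \<beta> (a n) (b n);
           logNK = ln (real (n * K n));
           B = 1 * entropy_ratio n (K n) (a n) (b n);
           \<eta> = \<epsilon> n / (4 * \<Delta>);
           \<gamma>\<^sub>0 = \<eta> - B;
           s = (\<lambda>\<alpha>. (1 * logNK + ln (4 / \<alpha>)) / \<gamma>\<^sub>0);
           \<alpha>\<^sub>3 = 1 / real (n * K n) * exp (- c\<^sub>3 * \<epsilon> n / 2);
           rest = exp (- 1 * S) + exp (- 1 * (a n + ln (real n)))
       in
         \<gamma>\<^sub>0 > 0 \<and>
         (\<eta> \<ge> 2 * B \<longrightarrow>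
            0 < \<alpha>\<^sub>3 \<and> \<alpha>\<^sub>3 < 1 / 2 \<and> s \<alpha>\<^sub>3 \<le> D * (\<Delta> * (logNK / \<epsilon> n) + \<Delta>)) \<and>
         (\<forall>\<sigma>\<^sub>0 \<in> balanced n (K n) \<beta>. \<forall>M.
            private_extension n (K n) \<beta> w C (a n) (b n) (\<epsilon> n) M \<longrightarrow>
            (\<forall>\<alpha>. 0 < \<alpha> \<and> \<alpha> < 1 / 2 \<longrightarrow>
               risk n (K n) (a n) (b n) \<sigma>\<^sub>0 M
                 \<le> exp (- (1 + \<delta> n) * S + tstar n (a n) (b n) * s \<alpha>) + \<alpha> + rest) \<and>
            (\<eta> \<ge> 2 * B \<longrightarrow>
               risk n (K n) (a n) (b n) \<sigma>\<^sub>0 M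
                 \<le> exp (- (1 + \<delta> n) * S + D * (\<Delta> * (logNK / \<epsilon> n)) + D * \<Delta>)
                    + \<alpha>\<^sub>3 + rest)))"
    (is "\<exists>\<delta>. _ \<and> (\<forall>\<^sub>F n in sequentially. ?P \<delta> n)")
proof -
  note inst = eventually_sbm_instance[OF reg \<rho> C]
  have Kmax: "2 \<le> Kmax" and \<beta>: "1 \<le> \<beta>"
  proof -
    obtain n where "sbm_instance n (K n) Kmax (a n) (b n) \<beta> \<rho>\<^sub>1 \<rho>\<^sub>2 C"
      using eventually_happens[OF inst] by auto
    then show "2 \<le> Kmax" "1 \<le> \<beta>" unfolding sbm_instance_def by linarith+
  qed
  define \<kappa> where "\<kappa> = (1 - sqrt \<rho>\<^sub>2)\<^sup>2"
  define T where "T = ln (2 / \<rho>\<^sub>1)"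
  define Q :: real where "Q = (1 + fact Kmax) * (exp 1 * real Kmax) + 1"
  \<comment> \<open>The explicit o(1): the first part comes from counting labelings with up to n /
    sqrt(ln n) errors as near, the second absorbs \<open>Q\<close>.\<close>
  define \<delta> where "\<delta> n = - (\<beta> * real Kmax / sqrt (ln (real n)) + ln Q / ln (real n))" for n :: nat
  define c where "c = min 1 (L * \<kappa> / (8 * C * \<beta> * real Kmax * T))"
  define G where "G = \<beta>\<^sup>2 * real Kmax ^ 4"
  have L_eq: "L = 16 * C * real (Kmax + 1) / \<kappa> + 1" and D_eq: "D = (1 + T) * (24 + 4 * c\<^sub>3)"
    by (simp_all only: L_def D_def T_def \<kappa>_def)
  have \<kappa>: "0 < \<kappa>" using \<rho> by (simp add: \<kappa>_def)
  have L: "0 < L" using C \<kappa> by (simp add: L_eq add_nonneg_pos)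
  have T: "0 < T" using \<rho> by (simp add: T_def)
  have c: "0 < c" using L \<kappa> C \<beta> Kmax T by (simp add: c_def)
  have G: "0 < G" using \<beta> Kmax by (simp add: G_def)
  have large1: "\<forall>\<^sub>F n in sequentially. 2 * ln (real Kmax) \<le> c * sqrt (ln (real n)) / G"
  proof -
    have "filterlim (\<lambda>n::nat. c * sqrt (ln (real n)) / G) at_top sequentially"
      using c G by real_asymp
    then show ?thesis by (simp add: filterlim_at_top)
  qed
  have large2: "\<forall>\<^sub>F n in sequentially. 2 * G * sqrt (ln (real n)) \<le> real n"
    using G by real_asymp
  have large3: "\<forall>\<^sub>F n in sequentially. Q \<le> real n" by real_asymp
  have "\<forall>\<^sub>F n in sequentially. ?P \<delta> n"
    using inst \<epsilon> large1 large2 large3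
  proof eventually_elim
    case (elim n)
    interpret sbm_instance n "K n" Kmax "a n" "b n" \<beta> \<rho>\<^sub>1 \<rho>\<^sub>2 C by (fact elim)
    let ?\<Delta> = "sens n C (a n)" and ?S = "Signal n (K n) \<beta> (a n) (b n)"
      and ?R = "entropy_ratio n (K n) (a n) (b n)" and ?l = "ln (real (n * K n))"
    let ?rest = "exp (- 1 * ?S) + exp (- 1 * (a n + ln (real n)))"
    let ?s = "\<lambda>\<alpha>. (1 * ?l + ln (4 / \<alpha>)) / (\<epsilon> n / (4 * ?\<Delta>) - 1 * ?R)"
    let ?\<alpha> = "1 / real (n * K n) * exp (- c\<^sub>3 * \<epsilon> n / 2)"
    have \<epsilon>n: "?R < \<epsilon> n / (4 * ?\<Delta>)" "0 < \<epsilon> n"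
      using noise_rate_gt elim by (simp_all add: L_eq \<kappa>_def)
    have risk: "risk n (K n) (a n) (b n) \<sigma>\<^sub>0 M
        \<le> exp (- (1 + \<delta> n) * ?S + tstar n (a n) (b n) * ?s \<alpha>) + \<alpha> + ?rest"
      if "\<sigma>\<^sub>0 \<in> balanced n (K n) \<beta>" "private_extension n (K n) \<beta> w C (a n) (b n) (\<epsilon> n) M"
        "0 < \<alpha>" "\<alpha> < 1 / 2" for \<sigma>\<^sub>0 M \<alpha>
    proof -
      have "risk n (K n) (a n) (b n) \<sigma>\<^sub>0 M
        \<le> exp (- (1 + \<delta> n) * ?S + tstar n (a n) (b n) * ?s \<alpha>) + \<alpha> + exp (- (a n + ln (real n)))"
        using risk_le_log_budget[OF that(2,1) w L_eq[unfolded \<kappa>_def] elim(2)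
            c_def[unfolded \<kappa>_def T_def] Q_def elim(3,4)[unfolded G_def] elim(5) that(3,4)]
        by (simp only: \<delta>_def mult_1 add_uminus_conv_diff)
      also have "exp (- (a n + ln (real n))) \<le> ?rest" by simp
      finally show ?thesis by simp
    qed
    have slack: "0 < ?\<alpha>" "?\<alpha> < 1 / 2" "?s ?\<alpha> \<le> (24 + 4 * c\<^sub>3) * (?\<Delta> * (?l / \<epsilon> n) + ?\<Delta>)"
      if "2 * ?R \<le> \<epsilon> n / (4 * ?\<Delta>)"
      using privacy_slack_le[OF \<epsilon>n(2) c\<^sub>3 that] by simp_all
    have X: "0 \<le> ?\<Delta> * (?l / \<epsilon> n) + ?\<Delta>" using sens_pos ln_nK_pos \<epsilon>n(2) by simp
    \<comment> \<open>The factor 1 + T in D exceeds both 1 and the bound T on t*, so one D serves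
      the bound on s* and the bound on t* s*.\<close>
    have "24 + 4 * c\<^sub>3 \<le> D" using T c\<^sub>3 by (simp add: D_eq algebra_simps)
    then have D1: "(24 + 4 * c\<^sub>3) * (?\<Delta> * (?l / \<epsilon> n) + ?\<Delta>) \<le> D * (?\<Delta> * (?l / \<epsilon> n) + ?\<Delta>)"
      using X by (rule mult_right_mono)
    have D2: "tstar n (a n) (b n) * ?s ?\<alpha> \<le> D * (?\<Delta> * (?l / \<epsilon> n)) + D * ?\<Delta>"
      if "2 * ?R \<le> \<epsilon> n / (4 * ?\<Delta>)"
    proof -
      have "tstar n (a n) (b n) * ?s ?\<alpha> \<le> tstar n (a n) (b n) * ((24 + 4 * c\<^sub>3) * (?\<Delta> * (?l / \<epsilon> n) + ?\<Delta>))"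
        using slack(3)[OF that] t_pos by (intro mult_left_mono) auto
      also have "\<dots> \<le> (1 + T) * ((24 + 4 * c\<^sub>3) * (?\<Delta> * (?l / \<epsilon> n) + ?\<Delta>))"
        using t_le X c\<^sub>3 by (intro mult_right_mono mult_nonneg_nonneg) (auto simp: T_def)
      also have "\<dots> = D * (?\<Delta> * (?l / \<epsilon> n) + ?\<Delta>)" by (simp only: D_eq mult.assoc)
      also have "\<dots> = D * (?\<Delta> * (?l / \<epsilon> n)) + D * ?\<Delta>" by (rule distrib_left)
      finally show ?thesis .
    qed
    have risk2: "risk n (K n) (a n) (b n) \<sigma>\<^sub>0 M
        \<le> exp (- (1 + \<delta> n) * ?S + D * (?\<Delta> * (?l / \<epsilon> n)) + D * ?\<Delta>) + ?\<alpha> + ?rest"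
      if "\<sigma>\<^sub>0 \<in> balanced n (K n) \<beta>" "private_extension n (K n) \<beta> w C (a n) (b n) (\<epsilon> n) M"
        "2 * ?R \<le> \<epsilon> n / (4 * ?\<Delta>)" for \<sigma>\<^sub>0 M
    proof -
      have "exp (- (1 + \<delta> n) * ?S + tstar n (a n) (b n) * ?s ?\<alpha>)
          \<le> exp (- (1 + \<delta> n) * ?S + D * (?\<Delta> * (?l / \<epsilon> n)) + D * ?\<Delta>)"
        using D2[OF that(3)] by simp
      then show ?thesis using risk[OF that(1,2) slack(1,2)[OF that(3)]] by linarith
    qed
    show ?case
      unfolding Let_def
      using \<epsilon>n(1) slack order_trans[OF slack(3) D1] risk risk2 by auto
  qed
  moreover have "\<delta> \<longlonglongrightarrow> 0" unfolding \<delta>_def by real_asymp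
  ultimately show ?thesis by blast
qed

theorem corollary3p6:
  shows "\<exists>Cs > 0. \<forall>(\<beta>::real) (\<rho>\<^sub>1::real) (\<rho>\<^sub>2::real) (Kmax::nat) (w::real) (C::real).
    1 \<le> \<beta> \<and> 0 < \<rho>\<^sub>1 \<and> \<rho>\<^sub>1 \<le> \<rho>\<^sub>2 \<and> \<rho>\<^sub>2 < 1 \<and> 0 \<le> w \<and> w \<le> 1 \<and> 0 < C \<longrightarrow>
    (\<forall>c > 0. \<exists>c' > 0. \<forall>K a b \<epsilon>. regime Cs \<beta> \<rho>\<^sub>1 \<rho>\<^sub>2 Kmax C K a b \<longrightarrow>
       (\<forall>\<^sub>F n in sequentially. \<epsilon> n \<ge> c * (sens n C (a n) * entropy_ratio n (K n) (a n) (b n))) \<longrightarrow>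
       (\<forall>\<^sub>F n in sequentially. \<epsilon> n \<ge> c' * ln (real n))) \<and>
    (\<forall>c > 0. \<exists>c' > 0. \<forall>K a b \<epsilon>. regime Cs \<beta> \<rho>\<^sub>1 \<rho>\<^sub>2 Kmax C K a b \<longrightarrow>
       (\<forall>\<^sub>F n in sequentially. \<epsilon> n \<ge> c * ln (real n)) \<longrightarrow>
       (\<forall>\<^sub>F n in sequentially. \<epsilon> n \<ge> c' * (sens n C (a n) * entropy_ratio n (K n) (a n) (b n)))) \<and>
    (\<exists>L > 0. \<exists>c\<^sub>0 > 0. \<exists>c\<^sub>1 > 0. \<exists>C\<^sub>0 > 0. \<exists>C\<^sub>1 > 0. \<forall>c\<^sub>3 > 0. \<exists>D > 0.
       \<forall>K a b \<epsilon>. regime Cs \<beta> \<rho>\<^sub>1 \<rho>\<^sub>2 Kmax C K a b \<longrightarrow>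
       (\<forall>\<^sub>F n in sequentially. \<epsilon> n \<ge> L * ln (real n)) \<longrightarrow>
       (\<exists>\<delta> :: nat \<Rightarrow> real. \<delta> \<longlonglongrightarrow> 0 \<and>
         (\<forall>\<^sub>F n in sequentially.
            let \<Delta> = sens n C (a n);
                S = Signal n (K n) \<beta> (a n) (b n);
                logNK = ln (real (n * K n));
                B = C\<^sub>0 * entropy_ratio n (K n) (a n) (b n);
                \<eta> = \<epsilon> n / (4 * \<Delta>);
                \<gamma>\<^sub>0 = \<eta> - B;
                s = (\<lambda>\<alpha>. (C\<^sub>1 * logNK + ln (4 / \<alpha>)) / \<gamma>\<^sub>0);
                \<alpha>\<^sub>3 = 1 / real (n * K n) * exp (- c\<^sub>3 * \<epsilon> n / 2);
                rest = exp (- c\<^sub>0 * S) + exp (- c\<^sub>1 * (a n + ln (real n)))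
            in
              \<gamma>\<^sub>0 > 0 \<and>
              (\<eta> \<ge> 2 * B \<longrightarrow>
                 0 < \<alpha>\<^sub>3 \<and> \<alpha>\<^sub>3 < 1 / 2 \<and> s \<alpha>\<^sub>3 \<le> D * (\<Delta> * (logNK / \<epsilon> n) + \<Delta>)) \<and>
              (\<forall>\<sigma>\<^sub>0 \<in> balanced n (K n) \<beta>. \<forall>M.
                 private_extension n (K n) \<beta> w C (a n) (b n) (\<epsilon> n) M \<longrightarrow>
                 (\<forall>\<alpha>. 0 < \<alpha> \<and> \<alpha> < 1 / 2 \<longrightarrow>
                    risk n (K n) (a n) (b n) \<sigma>\<^sub>0 M
                      \<le> exp (- (1 + \<delta> n) * S + tstar n (a n) (b n) * s \<alpha>) + \<alpha> + rest) \<and>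
                 (\<eta> \<ge> 2 * B \<longrightarrow>
                    risk n (K n) (a n) (b n) \<sigma>\<^sub>0 M
                      \<le> exp (- (1 + \<delta> n) * S + D * (\<Delta> * (logNK / \<epsilon> n)) + D * \<Delta>)
                         + \<alpha>\<^sub>3 + rest)))))"
proof (rule exI[of _ 1], intro conjI allI impI, goal_cases)
  \<comment> \<open>The separation constant is 1: all that the estimates take from it is Signal >=
    ln(nK).\<close>
  case 1
  show ?case by simp
next
  case (2 \<beta> \<rho>\<^sub>1 \<rho>\<^sub>2 Kmax w C c)
  \<comment> \<open>The witness \<open>c'\<close> is read off from the lemma; only its positivity is
    supplied here, and likewise in the next case.\<close>
  then have "0 < c * C" by simp
  with 2 feasible_imp_log_budget show ?case by blast
next
  case (3 \<beta> \<rho>\<^sub>1 \<rho>\<^sub>2 Kmax w C c)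
  then have "0 < c / (4 * C * real (Kmax + 1) / (1 - sqrt \<rho>\<^sub>2)\<^sup>2)" by simp
  with 3 log_budget_imp_feasible show ?case by blast
next
  case (4 \<beta> \<rho>\<^sub>1 \<rho>\<^sub>2 Kmax w C)
  then have L: "0 < 16 * C * real (Kmax + 1) / (1 - sqrt \<rho>\<^sub>2)\<^sup>2 + 1"
    by (intro add_nonneg_pos) auto
  have D: "0 < (1 + ln (2 / \<rho>\<^sub>1)) * (24 + 4 * c)" if "0 < c" for c
    using 4 that by (intro mult_pos_pos add_pos_pos) auto
  show ?case
    \<comment> \<open>The facts \<open>L\<close> and \<open>D\<close> determine the first and the
      last witness; the four constants in between are set to 1.\<close>
    by (rule exI, rule conjI[OF L], (rule exI[of _ 1], rule conjI[OF zero_less_one])+,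
        intro allI impI, rule exI, rule conjI[OF D], assumption,
        intro allI impI, rule log_budget_sufficient) (use 4 in auto)
qed

end
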